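(* Let $k$ be an algebraically closed field and let $Q$ be a finite cyclically oriented quiver such that: i) for any arrow $\alpha$ of $Q$ there are at most $2$ anti-parallel shortest paths to $\alpha$; ii) the cyclic sequence of any oriented chordless cycle $c$ of $Q$ is finite. If $W$ is a primitive potential of $Q$, then the Jacobian algebra $\mathcal{P}(Q,W)$ is a finite dimensional $k$-algebra.
   Context: **Jacobian algebras.** For a finite quiver $Q$, $k\langle\langle Q\rangle\rangle=\prod_{d\ge 0}A^d$ is the complete path algebra, where $A^d$ is spanned by the paths of length $d$, with the $\mathfrak m$-adic topology, $\mathfrak m=\prod_{d\geq 1}A^d$. A potential $W$ is a (possibly infinite) linear combination of cyclic paths. For an arrow $a$, the cyclic derivative $\partial_a$ is the continuous $k$-linear map with $\partial_a(a_1\cdots a_d)=\sum_{j:\,a_j=a}a_{j+1}\cdots a_d a_1\cdots a_{j-1}$ on cyclic paths. The Jacobian ideal $J(W)$ is the closure of the two-sided ideal generated by all $\partial_a(W)$, $a\in Q_1$, and $\mathcal{P}(Q,W)=k\langle\langle Q\rangle\rangle/J(W)$. For an arrow or path $\gamma$, $s(\gamma)$ and $t(\gamma)$ denote its source and target. **Cycles.** A walk of length $p$ is a tuple $(x_p,\alpha_p,x_{p-1},\ldots,x_1,\alpha_1,x_0)$ with $x_i\in Q_0$, $\alpha_i\in Q_1$ and $\{s(\alpha_i),t(\alpha_i)\}=\{x_i,x_{i-1}\}$ for all $i$. It is oriented if either $s(\alpha_i)=x_{i-1}$, $t(\alpha_i)=x_i$ for all $i$, or $s(\alpha_i)=x_i$,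 $t(\alpha_i)=x_{i-1}$ for all $i$. It is a cycle if $x_0=x_p$; a cycle of length $1$ is a loop. A cycle is non-intersecting if $x_1,\ldots,x_p$ are pairwise distinct; a non-intersecting cycle of length $2$ is called a $2$-cycle. A chord of a non-intersecting cycle is an arrow not among $\alpha_1,\dots,\alpha_p$ with both endpoints in $\{x_1,\dots,x_p\}$. A cycle is chordless if it is non-intersecting and has no chord. A quiver without loops and $2$-cycles is cyclically oriented if each chordless cycle is oriented (in particular it has no multiple arrows). A primitive potential of $Q$ is a linear combination, with all coefficients non-zero, of all the oriented chordless cycles of $Q$ (one representative for each cycle up to rotation). **Anti-parallel shortest paths.** A path $\gamma$ is anti-parallel to an arrow $\eta$ if $s(\gamma)=t(\eta)$ and $t(\gamma)=s(\eta)$. A path $\gamma$ anti-parallel to $\eta$ is an (anti-parallel) shortest path to $\eta$ if the oriented cycle formed by $\eta$ and $\gamma$ is chordless. **Cyclic sequences.** Let $Q$ be a cyclically oriented quiver in which each arrow has at most two anti-parallel shortest paths, and let $c=\beta_0\beta_1\cdots\beta_L$ be an oriented chordless cycle, presented with a starting arrow $\beta_0$. The cyclic sequence of $c$ is the sequence of triples $(\alpha_n,\rho_n,\rho_n')$, $n\ge 0$, where $\alpha_n$ is an arrow, $\rho'_n$ is an anti-parallel shortest path to $\alpha_n$, and $\rho_n$ is either the other anti-parallel shortest path to $\alpha_n$ or the symbol $0$, defined as follows. Step 0: $\alpha_0=\beta_0$ and $\rho_0'=\beta_1\cdots\beta_L$. If there is an anti-parallel shortest path $\rho_0\neq\rho_0'$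 to $\alpha_0$, the first triple is $(\alpha_0,\rho_0,\rho_0')$; otherwise the whole sequence is constant equal to $(\alpha_0,0,\rho_0')$. Step $i\geq 1$ (if the sequence has not yet become constant): $\alpha_i$ is the arrow of the path $\rho_{i-1}$ such that $s(\alpha_i)=t(\alpha_{i-1})$ if $i$ is odd, and such that $t(\alpha_i)=s(\alpha_{i-1})$ if $i$ is even; $\rho_i'$ is the anti-parallel shortest path to $\alpha_i$ contained in the cycle formed by $\alpha_{i-1}$ and $\rho_{i-1}$. If there is an anti-parallel shortest path $\rho_i\ne\rho_i'$ to $\alpha_i$, the next triple is $(\alpha_i,\rho_i,\rho_i')$; otherwise $(\alpha_n,\rho_n,\rho_n')=(\alpha_i,0,\rho_i')$ for all $n\ge i$. The cyclic sequence is finite if there is $m$ with $(\alpha_n,\rho_n,\rho_n')=(\alpha_m,0,\rho_m')$ for all $n\ge m$. Since the sequence depends on the choice of starting arrow of $c$, the requirement that the cyclic sequence of any oriented chordless cycle be finite is imposed for every oriented chordless cycle and every choice of its starting arrow. *)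

theory Defs
  imports
    "HOL-Algebra.Embedded_Algebras"
    "HOL-Algebra.Ideal_Product"
    "HOL-Algebra.QuotRing"
    "HOL-Analysis.Function_Topology"
    "HOL-Computational_Algebra.Polynomial"
    "Graph_Theory.Arc_Walk"
begin

text \<open>
  A finite quiver is a \<^locale>\<open>fin_digraph\<close>: the source of an arrow is its \<^const>\<open>tail\<close>, its target
  is its \<^const>\<open>head\<close>; loops and multiple arrows are allowed. Paths are written from left to right:
  in \<open>a\<^sub>1 a\<^sub>2\<close> the target of \<open>a\<^sub>1\<close> is the source of \<open>a\<^sub>2\<close>.
\<close>

section \<open>Walks, cycles and cyclically oriented quivers\<close>

text \<open>
  A walk with vertices \<open>x\<^sub>0, \<dots>, x\<^sub>p\<close> and arrows \<open>\<alpha>\<^sub>1, \<dots>, \<alpha>\<^sub>p\<close> is given by the list \<open>xs\<close> of its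
  vertices and the list \<open>as\<close> of its arrows, so that \<open>as ! i\<close> is \<open>\<alpha>\<^bsub>i+1\<^esub>\<close>.
\<close>

definition is_walk :: "('v, 'e) pre_digraph \<Rightarrow> 'v list \<Rightarrow> 'e list \<Rightarrow> bool" where
  "is_walk Q xs as \<longleftrightarrow>
     length xs = Suc (length as) \<and> set xs \<subseteq> verts Q \<and> set as \<subseteq> arcs Q \<and>
     (\<forall>i<length as. {tail Q (as ! i), head Q (as ! i)} = {xs ! Suc i, xs ! i})"

definition oriented_walk :: "('v, 'e) pre_digraph \<Rightarrow> 'v list \<Rightarrow> 'e list \<Rightarrow> bool" where
  "oriented_walk Q xs as \<longleftrightarrow>
     (\<forall>i<length as. tail Q (as ! i) = xs ! i \<and> head Q (as ! i) = xs ! Suc i) \<or>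
     (\<forall>i<length as. tail Q (as ! i) = xs ! Suc i \<and> head Q (as ! i) = xs ! i)"

definition is_cycle :: "('v, 'e) pre_digraph \<Rightarrow> 'v list \<Rightarrow> 'e list \<Rightarrow> bool" where
  "is_cycle Q xs as \<longleftrightarrow> is_walk Q xs as \<and> as \<noteq> [] \<and> hd xs = last xs"

text \<open>
  The arrows of a non-intersecting cycle are required to be distinct. In length \<open>\<noteq> 2\<close> this is
  automatic; in length 2 it excludes the walk that goes back and forth along a single arrow, which
  would otherwise be a 2-cycle (or a chordless, non-oriented cycle) in every quiver with an arrow.
\<close>

definition nonintersecting_cycle :: "('v, 'e) pre_digraph \<Rightarrow> 'v list \<Rightarrow> 'e list \<Rightarrow> bool" where
  "nonintersecting_cycle Q xs as \<longleftrightarrow> is_cycle Q xs as \<and> distinct (tl xs) \<and> distinct as"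

definition chord :: "('v, 'e) pre_digraph \<Rightarrow> 'v list \<Rightarrow> 'e list \<Rightarrow> 'e \<Rightarrow> bool" where
  "chord Q xs as b \<longleftrightarrow> b \<in> arcs Q \<and> b \<notin> set as \<and> tail Q b \<in> set (tl xs) \<and> head Q b \<in> set (tl xs)"

definition chordless_cycle :: "('v, 'e) pre_digraph \<Rightarrow> 'v list \<Rightarrow> 'e list \<Rightarrow> bool" where
  "chordless_cycle Q xs as \<longleftrightarrow> nonintersecting_cycle Q xs as \<and> (\<nexists>b. chord Q xs as b)"

definition cyclically_oriented :: "('v, 'e) pre_digraph \<Rightarrow> bool" where
  "cyclically_oriented Q \<longleftrightarrow>
     (\<nexists>xs as. is_cycle Q xs as \<and> length as = 1) \<and>
     (\<nexists>xs as. nonintersecting_cycle Q xs as \<and> length as = 2) \<and>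
     (\<forall>xs as. chordless_cycle Q xs as \<longrightarrow> oriented_walk Q xs as)"

text \<open>
  An oriented chordless cycle presented with a starting arrow, i.e. as the list \<open>c\<close> of its arrows
  in the order in which they compose; every choice of the starting arrow gives its own list.
\<close>

definition oriented_chordless_cycle :: "('v, 'e) pre_digraph \<Rightarrow> 'e list \<Rightarrow> bool" where
  "oriented_chordless_cycle Q c \<longleftrightarrow>
     (\<exists>u. pre_digraph.awalk Q u c u \<and> chordless_cycle Q (pre_digraph.awalk_verts Q u c) c)"


section \<open>Anti-parallel shortest paths and cyclic sequences\<close>

definition antiparallel :: "('v, 'e) pre_digraph \<Rightarrow> 'e list \<Rightarrow> 'e \<Rightarrow> bool" where
  "antiparallel Q \<gamma> \<eta> \<longleftrightarrow> \<eta> \<in> arcs Q \<and> pre_digraph.awalk Q (head Q \<eta>) \<gamma> (tail Q \<eta>)"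

definition shortest_path :: "('v, 'e) pre_digraph \<Rightarrow> 'e list \<Rightarrow> 'e \<Rightarrow> bool" where
  "shortest_path Q \<gamma> \<eta> \<longleftrightarrow> antiparallel Q \<gamma> \<eta> \<and> oriented_chordless_cycle Q (\<eta> # \<gamma>)"

text \<open>
  The component \<open>\<rho>\<^sub>n\<close> of a triple of a cyclic sequence; \<^const>\<open>None\<close> is the symbol 0. If \<open>\<eta>\<close> has at
  most two anti-parallel shortest paths, there is at most one candidate different from \<open>\<rho>'\<close>.
\<close>

definition other_shortest_path ::
    "('v, 'e) pre_digraph \<Rightarrow> 'e \<Rightarrow> 'e list \<Rightarrow> 'e list option" where
  "other_shortest_path Q \<eta> \<rho>' =
     (if \<exists>\<rho>. shortest_path Q \<rho> \<eta> \<and> \<rho> \<noteq> \<rho>'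
      then Some (THE \<rho>. shortest_path Q \<rho> \<eta> \<and> \<rho> \<noteq> \<rho>') else None)"

definition next_arrow :: "('v, 'e) pre_digraph \<Rightarrow> nat \<Rightarrow> 'e \<Rightarrow> 'e list \<Rightarrow> 'e" where
  "next_arrow Q i \<alpha> \<rho> =
     (THE b. b \<in> set \<rho> \<and> (if odd i then tail Q b = head Q \<alpha> else head Q b = tail Q \<alpha>))"

definition next_path :: "('v, 'e) pre_digraph \<Rightarrow> 'e \<Rightarrow> 'e list \<Rightarrow> 'e \<Rightarrow> 'e list" where
  "next_path Q \<alpha> \<rho> \<beta> = (THE \<gamma>. shortest_path Q \<gamma> \<beta> \<and> set \<gamma> \<subseteq> insert \<alpha> (set \<rho>))"

primrec cyclic_sequence ::
    "('v, 'e) pre_digraph \<Rightarrow> 'e list \<Rightarrow> nat \<Rightarrow> 'e \<times> 'e list option \<times> 'e list" where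
  "cyclic_sequence Q c 0 = (hd c, other_shortest_path Q (hd c) (tl c), tl c)"
| "cyclic_sequence Q c (Suc n) =
     (case cyclic_sequence Q c n of
        (\<alpha>, None, \<rho>') \<Rightarrow> (\<alpha>, None, \<rho>')
      | (\<alpha>, Some \<rho>, \<rho>') \<Rightarrow>
          (let \<beta> = next_arrow Q (Suc n) \<alpha> \<rho>; \<sigma>' = next_path Q \<alpha> \<rho> \<beta>
           in (\<beta>, other_shortest_path Q \<beta> \<sigma>', \<sigma>')))"

definition finite_cyclic_sequence :: "('v, 'e) pre_digraph \<Rightarrow> 'e list \<Rightarrow> bool" where
  "finite_cyclic_sequence Q c \<longleftrightarrow>
     (\<exists>m \<alpha> \<rho>'. \<forall>n\<ge>m. cyclic_sequence Q c n = (\<alpha>, None, \<rho>'))"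


section \<open>The complete path algebra\<close>

text \<open>
  A path is a pair of its source and the list of its arrows; \<open>(v, [])\<close> is the trivial path at \<open>v\<close>.
  An element of \<open>k\<langle>\<langle>Q\<rangle>\<rangle>\<close> is the family of its coefficients. Since \<open>Q\<close> is finite,
  there are only finitely many paths of each length, so the product over \<open>d\<close> of the spaces spanned
  by the paths of length \<open>d\<close> consists of all families supported on paths.
\<close>

type_synonym ('v, 'e) qpath = "'v \<times> 'e list"

definition is_path :: "('v, 'e) pre_digraph \<Rightarrow> ('v, 'e) qpath \<Rightarrow> bool" where
  "is_path Q x \<longleftrightarrow> (\<exists>v. pre_digraph.awalk Q (fst x) (snd x) v)"

definition complete_path_algebra ::
    "('v, 'e) pre_digraph \<Rightarrow> (('v, 'e) qpath \<Rightarrow> 'k::field) ring" where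
  "complete_path_algebra Q =
     \<lparr>carrier = {f. \<forall>x. f x \<noteq> 0 \<longrightarrow> is_path Q x},
      monoid.mult = (\<lambda>f g. \<lambda>(u, p). \<Sum>i\<le>length p.
                f (u, take i p) * g (last (pre_digraph.awalk_verts Q u (take i p)), drop i p)),
      one = (\<lambda>(u, p). if u \<in> verts Q \<and> p = [] then 1 else 0),
      zero = (\<lambda>_. 0),
      add = (\<lambda>f g x. f x + g x)\<rparr>"

lemma last_awalk_verts_append:
  "last (pre_digraph.awalk_verts Q (last (pre_digraph.awalk_verts Q u p)) q) =
   last (pre_digraph.awalk_verts Q u (p @ q))"
  by (simp add: pre_digraph.awalk_verts_conv)


lemma sum_triangle_shift:
  fixes a :: "nat \<Rightarrow> nat \<Rightarrow> 'a::comm_monoid_add"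
  shows "(\<Sum>i\<le>n. \<Sum>j\<le>i. a j (i - j)) = (\<Sum>j\<le>n. \<Sum>k\<le>n - j. a j k)"
proof -
  have "(\<Sum>i\<le>n. \<Sum>j\<le>i. a j (i - j)) = (\<Sum>(j,k)\<in>{(j,k). j + k \<le> n}. a j k)"
    by (simp add: sum.triangle_reindex_eq)
  also have "{(j,k). j + k \<le> n} = (SIGMA j:{..n}. {..n - j})" by auto
  also have "(\<Sum>(j,k)\<in>(SIGMA j:{..n}. {..n - j}). a j k) = (\<Sum>j\<le>n. \<Sum>k\<le>n - j. a j k)"
    by (simp add: sum.Sigma)
  finally show ?thesis .
qed

lemma complete_path_algebra_assoc:
  fixes f g h :: "('v,'e) qpath \<Rightarrow> 'k::field"
  shows "(f \<otimes>\<^bsub>complete_path_algebra Q\<^esub> g) \<otimes>\<^bsub>complete_path_algebra Q\<^esub> h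
    = f \<otimes>\<^bsub>complete_path_algebra Q\<^esub> (g \<otimes>\<^bsub>complete_path_algebra Q\<^esub> h)"
proof (rule ext, clarify)
  fix u p
  let ?e = "\<lambda>u q. last (pre_digraph.awalk_verts Q u q)"
  let ?a = "\<lambda>j k. f (u, take j p) * (g (?e u (take j p), take k (drop j p)) * h (?e u (take (j + k) p), drop (j + k) p))"
  have "((f \<otimes>\<^bsub>complete_path_algebra Q\<^esub> g) \<otimes>\<^bsub>complete_path_algebra Q\<^esub> h) (u, p)
     = (\<Sum>i\<le>length p. \<Sum>j\<le>i. ?a j (i - j))"
    unfolding complete_path_algebra_def
    by (auto simp: sum_distrib_right min_def drop_take mult.assoc intro!: sum.cong)
  also have "\<dots> = (\<Sum>j\<le>length p. \<Sum>k\<le>length p - j. ?a j k)" by (rule sum_triangle_shift)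
  also have "\<dots> = (f \<otimes>\<^bsub>complete_path_algebra Q\<^esub> (g \<otimes>\<^bsub>complete_path_algebra Q\<^esub> h)) (u, p)"
    unfolding complete_path_algebra_def
    by (auto simp: sum_distrib_left last_awalk_verts_append take_add add.commute intro!: sum.cong)
  finally show "((f \<otimes>\<^bsub>complete_path_algebra Q\<^esub> g) \<otimes>\<^bsub>complete_path_algebra Q\<^esub> h) (u, p) = (f \<otimes>\<^bsub>complete_path_algebra Q\<^esub> (g \<otimes>\<^bsub>complete_path_algebra Q\<^esub> h)) (u, p)" .
qed

lemma cas_awlast:
  "pre_digraph.cas Q u p v \<Longrightarrow> last (pre_digraph.awalk_verts Q u p) = v"
proof (induction p arbitrary: u)
  case Nil
  then show ?case by (simp add: pre_digraph.cas.simps pre_digraph.awalk_verts.simps)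
next
  case (Cons a p)
  then have "last (pre_digraph.awalk_verts Q (head Q a) p) = v"
    by (simp add: pre_digraph.cas.simps)
  then show ?case by (simp add: pre_digraph.awalk_verts_conv split: if_splits)
qed

lemma is_path_iff:
  "is_path Q (u, p) \<longleftrightarrow> pre_digraph.awalk Q u p (last (pre_digraph.awalk_verts Q u p))"
  unfolding is_path_def pre_digraph.awalk_def fst_conv snd_conv by (metis cas_awlast)

lemma cas_appendI:
  "pre_digraph.cas Q u p v \<Longrightarrow> pre_digraph.cas Q v q w \<Longrightarrow> pre_digraph.cas Q u (p @ q) w"
  by (induction p arbitrary: u) (simp_all add: pre_digraph.cas.simps)

lemma is_path_append:
  assumes "is_path Q (u, p)" "is_path Q (last (pre_digraph.awalk_verts Q u p), q)"
  shows "is_path Q (u, p @ q)"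
proof -
  let ?v = "last (pre_digraph.awalk_verts Q u p)"
  obtain w where "pre_digraph.awalk Q ?v q w"
    using assms(2) unfolding is_path_def fst_conv snd_conv by blast
  moreover have "pre_digraph.awalk Q u p ?v" using assms(1) unfolding is_path_iff .
  ultimately have "pre_digraph.awalk Q u (p @ q) w"
    unfolding pre_digraph.awalk_def by (simp add: cas_appendI[of Q u p ?v q w])
  then show ?thesis unfolding is_path_def by auto
qed

lemma is_path_ends: "fin_digraph Q \<Longrightarrow> is_path Q (u,p) \<Longrightarrow> u \<in> verts Q \<and> last (pre_digraph.awalk_verts Q u p) \<in> verts Q"
  unfolding is_path_iff
  by (meson fin_digraph.axioms(1) wf_digraph.awalk_hd_in_verts wf_digraph.awalk_last_in_verts)

lemma complete_path_algebra_ring: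
  assumes "fin_digraph Q"
  shows "ring (complete_path_algebra Q :: (('v,'e) qpath \<Rightarrow> 'k::field) ring)"
proof (rule ringI)
  let ?R = "complete_path_algebra Q :: (('v,'e) qpath \<Rightarrow> 'k::field) ring"
  show "abelian_group ?R"
  proof (rule abelian_groupI)
    fix f g assume fg: "f \<in> carrier ?R" "g \<in> carrier ?R"
    have "f x \<noteq> 0 \<or> g x \<noteq> 0" if "f x + g x \<noteq> 0" for x
      using that by (cases "f x = 0") simp_all
    then show "f \<oplus>\<^bsub>?R\<^esub> g \<in> carrier ?R"
      using fg unfolding complete_path_algebra_def by simp blast
    show "f \<oplus>\<^bsub>?R\<^esub> g = g \<oplus>\<^bsub>?R\<^esub> f"
      by (rule ext) (simp add: complete_path_algebra_def add.commute)
  next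
    fix f g h
    show "(f \<oplus>\<^bsub>?R\<^esub> g) \<oplus>\<^bsub>?R\<^esub> h = f \<oplus>\<^bsub>?R\<^esub> (g \<oplus>\<^bsub>?R\<^esub> h)"
      by (rule ext) (simp add: complete_path_algebra_def add.assoc)
  next
    fix f assume f: "f \<in> carrier ?R"
    show "\<zero>\<^bsub>?R\<^esub> \<oplus>\<^bsub>?R\<^esub> f = f"
      by (rule ext) (simp add: complete_path_algebra_def)
    show "\<exists>g\<in>carrier ?R. g \<oplus>\<^bsub>?R\<^esub> f = \<zero>\<^bsub>?R\<^esub>"
      using f by (intro bexI[of _ "\<lambda>x. - f x"]) (simp_all add: complete_path_algebra_def)
  qed (simp add: complete_path_algebra_def)
  show "monoid ?R"
  proof (rule monoidI)
    fix f g assume fg: "f \<in> carrier ?R" "g \<in> carrier ?R"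
    show "f \<otimes>\<^bsub>?R\<^esub> g \<in> carrier ?R"
    proof -
      have "is_path Q (u,p)" if nz: "(f \<otimes>\<^bsub>?R\<^esub> g) (u,p) \<noteq> 0" for u p
      proof -
        from nz obtain i where "i \<le> length p" "f (u, take i p) * g (last (pre_digraph.awalk_verts Q u (take i p)), drop i p) \<noteq> 0"
          unfolding complete_path_algebra_def by (auto elim: sum.not_neutral_contains_not_neutral)
        then have "is_path Q (u, take i p)" "is_path Q (last (pre_digraph.awalk_verts Q u (take i p)), drop i p)"
          using fg by (auto simp: complete_path_algebra_def)
        then show ?thesis using is_path_append[of Q u "take i p" "drop i p"] by simp
      qed
      then show ?thesis by (auto simp: complete_path_algebra_def)
    qed
  next
    show "\<one>\<^bsub>?R\<^esub> \<in> carrier ?R"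
      by (auto simp: complete_path_algebra_def is_path_def pre_digraph.awalk_def pre_digraph.cas.simps split: if_splits)
  next
    fix f assume "f \<in> carrier ?R"
    then have f: "is_path Q (u, p)" if "f (u, p) \<noteq> 0" for u p
      using that by (simp add: complete_path_algebra_def)
    show "\<one>\<^bsub>?R\<^esub> \<otimes>\<^bsub>?R\<^esub> f = f"
    proof (rule ext, clarify)
      fix u p
      have z: "u \<notin> verts Q \<Longrightarrow> f (u,p) = 0"
        using f[of u p] is_path_ends[OF assms, of u p] by blast
      have "(\<one>\<^bsub>?R\<^esub> \<otimes>\<^bsub>?R\<^esub> f) (u,p) = (\<Sum>i\<le>length p. if i = 0 then f (u,p) else 0)"
        unfolding complete_path_algebra_def
        by (simp del: sum.delta sum.delta', rule sum.cong)
           (use z in \<open>auto simp: pre_digraph.awalk_verts.simps\<close>)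
      then show "(\<one>\<^bsub>?R\<^esub> \<otimes>\<^bsub>?R\<^esub> f) (u,p) = f (u,p)" by simp
    qed
    show "f \<otimes>\<^bsub>?R\<^esub> \<one>\<^bsub>?R\<^esub> = f"
    proof (rule ext, clarify)
      fix u p
      have z: "last (pre_digraph.awalk_verts Q u p) \<notin> verts Q \<Longrightarrow> f (u,p) = 0"
        using f[of u p] is_path_ends[OF assms, of u p] by blast
      have "(f \<otimes>\<^bsub>?R\<^esub> \<one>\<^bsub>?R\<^esub>) (u,p) = (\<Sum>i\<le>length p. if i = length p then f (u,p) else 0)"
        unfolding complete_path_algebra_def
        by (simp del: sum.delta sum.delta', rule sum.cong) (use z in auto)
      then show "(f \<otimes>\<^bsub>?R\<^esub> \<one>\<^bsub>?R\<^esub>) (u,p) = f (u,p)" by simp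
    qed
  qed (rule complete_path_algebra_assoc)
next
  let ?R = "complete_path_algebra Q :: (('v,'e) qpath \<Rightarrow> 'k::field) ring"
  fix f g h
  show "(f \<oplus>\<^bsub>?R\<^esub> g) \<otimes>\<^bsub>?R\<^esub> h = f \<otimes>\<^bsub>?R\<^esub> h \<oplus>\<^bsub>?R\<^esub> g \<otimes>\<^bsub>?R\<^esub> h"
    by (rule ext) (simp add: complete_path_algebra_def case_prod_beta distrib_right sum.distrib)
  show "h \<otimes>\<^bsub>?R\<^esub> (f \<oplus>\<^bsub>?R\<^esub> g) = h \<otimes>\<^bsub>?R\<^esub> f \<oplus>\<^bsub>?R\<^esub> h \<otimes>\<^bsub>?R\<^esub> g"
    by (rule ext) (simp add: complete_path_algebra_def case_prod_beta distrib_left sum.distrib)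
qed

definition path_element :: "('v, 'e) qpath \<Rightarrow> ('v, 'e) qpath \<Rightarrow> 'k::field" where
  "path_element x = (\<lambda>y. if y = x then 1 else 0)"

definition arrow_ideal :: "('v, 'e) pre_digraph \<Rightarrow> (('v, 'e) qpath \<Rightarrow> 'k::field) set" where
  "arrow_ideal Q = {f \<in> carrier (complete_path_algebra Q). \<forall>x. f x \<noteq> 0 \<longrightarrow> 1 \<le> length (snd x)}"

primrec ideal_power :: "('a, 'b) ring_scheme \<Rightarrow> 'a set \<Rightarrow> nat \<Rightarrow> 'a set" where
  "ideal_power R I 0 = carrier R"
| "ideal_power R I (Suc n) = ideal_prod R (ideal_power R I n) I"

definition adic_topology :: "('a, 'b) ring_scheme \<Rightarrow> 'a set \<Rightarrow> 'a topology" where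
  "adic_topology R I =
     topology_generated_by {ideal_power R I n +>\<^bsub>R\<^esub> x | n x. x \<in> carrier R}"


section \<open>Potentials and Jacobian algebras\<close>

definition cyclic_path :: "('v, 'e) pre_digraph \<Rightarrow> ('v, 'e) qpath \<Rightarrow> bool" where
  "cyclic_path Q x \<longleftrightarrow> snd x \<noteq> [] \<and> pre_digraph.awalk Q (fst x) (snd x) (fst x)"

text \<open>
  The coefficient of \<open>\<partial>\<^sub>a W\<close> at a path \<open>y\<close> collects the coefficients \<open>W x\<close> of all cyclic paths
  \<open>x = a\<^sub>1 \<dots> a\<^sub>d\<close> with a position \<open>j\<close> such that \<open>a\<^sub>j = a\<close> and
  \<open>a\<^bsub>j+1\<^esub> \<dots> a\<^sub>d a\<^sub>1 \<dots> a\<^bsub>j-1\<^esub> = y\<close>. Only finitely many pairs \<open>(x, j)\<close> occur for given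
  \<open>y\<close>, all of them with \<open>d = length y + 1\<close>, so this is the continuous linear extension.
\<close>

definition cyclic_occurrences ::
    "('v, 'e) pre_digraph \<Rightarrow> 'e \<Rightarrow> ('v, 'e) qpath \<Rightarrow> (('v, 'e) qpath \<times> nat) set" where
  "cyclic_occurrences Q a y =
     {(x, j). cyclic_path Q x \<and> j < length (snd x) \<and> snd x ! j = a \<and>
              y = (head Q a, drop (Suc j) (snd x) @ take j (snd x))}"

definition cyclic_derivative ::
    "('v, 'e) pre_digraph \<Rightarrow> 'e \<Rightarrow> (('v, 'e) qpath \<Rightarrow> 'k::field) \<Rightarrow> ('v, 'e) qpath \<Rightarrow> 'k" where
  "cyclic_derivative Q a W = (\<lambda>y. \<Sum>(x, j)\<in>cyclic_occurrences Q a y. W x)"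

lemma finite_cyclic_occurrences: "finite (cyclic_occurrences Q a y)"
proof -
  define f where "f = (\<lambda>j. let c = drop (length (snd y) - j) (snd y) @ a # take (length (snd y) - j) (snd y) in ((tail Q (hd c), c), j))"
  have "cyclic_occurrences Q a y \<subseteq> f ` {..length (snd y)}"
  proof clarify
    fix u p j assume "((u,p),j) \<in> cyclic_occurrences Q a y"
    then have h: "cyclic_path Q (u,p)" "j < length p" "p ! j = a" "snd y = drop (Suc j) p @ take j p"
      by (auto simp: cyclic_occurrences_def)
    then have "length (snd y) - j = length p - Suc j" "j \<le> length (snd y)" by auto
    moreover have "take j p @ a # drop (Suc j) p = p"
      using id_take_nth_drop[OF h(2)] h(3) by simp
    moreover have "u = tail Q (hd p)" using h(1)
      by (cases p) (auto simp: cyclic_path_def pre_digraph.awalk_def pre_digraph.cas.simps)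
    ultimately show "((u,p),j) \<in> f ` {..length (snd y)}"
      using h by (intro image_eqI[of _ _ j]) (auto simp: f_def Let_def)
  qed
  then show ?thesis using finite_surj by blast
qed

lemma cyclic_derivative_path:
  assumes "cyclic_path Q x"
  shows "cyclic_derivative Q a (path_element x) =
    (\<lambda>y. \<Sum>j | j < length (snd x) \<and> snd x ! j = a.
       path_element (head Q a, drop (Suc j) (snd x) @ take j (snd x)) y :: 'k::field)"
proof
  fix y
  let ?J = "{j. j < length (snd x) \<and> snd x ! j = a}"
  let ?r = "\<lambda>j. (head Q a, drop (Suc j) (snd x) @ take j (snd x))"
  have "cyclic_derivative Q a (path_element x :: _ \<Rightarrow> 'k) y
    = (\<Sum>z\<in>cyclic_occurrences Q a y. if fst z = x then 1 else 0)"
    by (simp add: cyclic_derivative_def path_element_def case_prod_beta)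
  also have "\<dots> = (\<Sum>z\<in>{z \<in> cyclic_occurrences Q a y. fst z = x}. 1)"
    by (rule sum.inter_filter[OF finite_cyclic_occurrences, symmetric])
  also have "{z \<in> cyclic_occurrences Q a y. fst z = x} = Pair x ` {j \<in> ?J. y = ?r j}"
    using assms by (auto simp: cyclic_occurrences_def)
  also have "(\<Sum>z\<in>\<dots>. 1) = (\<Sum>j\<in>{j \<in> ?J. y = ?r j}. 1::'k)"
    by (subst sum.reindex) (auto simp: inj_on_def)
  also have "\<dots> = (\<Sum>j\<in>?J. path_element (?r j) y)"
    unfolding path_element_def by (subst sum.inter_filter) auto
  finally show "cyclic_derivative Q a (path_element x :: _ \<Rightarrow> 'k) y = (\<Sum>j\<in>?J. path_element (?r j) y)" .
qed

definition jacobian_ideal ::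
    "('v, 'e) pre_digraph \<Rightarrow> (('v, 'e) qpath \<Rightarrow> 'k::field) \<Rightarrow> (('v, 'e) qpath \<Rightarrow> 'k) set" where
  "jacobian_ideal Q W =
     Abstract_Topology.closure_of (adic_topology (complete_path_algebra Q) (arrow_ideal Q))
       (Idl\<^bsub>complete_path_algebra Q\<^esub> ((\<lambda>a. cyclic_derivative Q a W) ` arcs Q))"

definition jacobian_algebra ::
    "('v, 'e) pre_digraph \<Rightarrow> (('v, 'e) qpath \<Rightarrow> 'k::field) \<Rightarrow> (('v, 'e) qpath \<Rightarrow> 'k) set ring" where
  "jacobian_algebra Q W = complete_path_algebra Q Quot jacobian_ideal Q W"

text \<open>The image of \<open>k\<close> in the Jacobian algebra, which gives it its structure of a \<open>k\<close>-algebra.\<close>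

definition jacobian_scalars ::
    "('v, 'e) pre_digraph \<Rightarrow> (('v, 'e) qpath \<Rightarrow> 'k::field) \<Rightarrow> (('v, 'e) qpath \<Rightarrow> 'k) set set" where
  "jacobian_scalars Q W =
     range (\<lambda>c. jacobian_ideal Q W +>\<^bsub>complete_path_algebra Q\<^esub>
                  (\<lambda>x. c * \<one>\<^bsub>complete_path_algebra Q\<^esub> x))"

definition primitive_potential ::
    "('v, 'e) pre_digraph \<Rightarrow> (('v, 'e) qpath \<Rightarrow> 'k::field) \<Rightarrow> bool" where
  "primitive_potential Q W \<longleftrightarrow>
     (\<exists>C a. (\<forall>c\<in>C. oriented_chordless_cycle Q c) \<and>
            (\<forall>c. oriented_chordless_cycle Q c \<longrightarrow> (\<exists>!d. d \<in> C \<and> (\<exists>n. d = rotate n c))) \<and>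
            (\<forall>c\<in>C. a c \<noteq> 0) \<and>
            W = (\<lambda>x. \<Sum>c\<in>C. a c * path_element (tail Q (hd c), c) x))"

end

theory Submission
  imports Defs
begin

text \<open>
  The relation \<open>\<partial>\<^sub>\<eta> W = 0\<close> kills the anti-parallel shortest path to \<open>\<eta>\<close> if there is only one, and makes
  the two of them proportional otherwise. Following a finite cyclic sequence, this turns every
  oriented chordless cycle, taken as a path, into zero. By induction on the number of vertices, every
  closed walk vanishes: an oriented cycle with a chord contains a shortest path to an arrow whose
  other shortest path lies on the remaining vertices of the cycle. Hence every path with at
  least as many arrows as \<open>Q\<close> has vertices lies in the ideal generated by the cyclic derivatives. So this
  ideal contains a power of the arrow ideal; it is therefore closed, and the short paths span the quotient.
\<close>

section \<open>Walks and chordless cycles\<close>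

text \<open>Only membership of single paths in the ideal is carried along: if all but one of the
  paths in a relation lie in the ideal, so does the last one, whatever its non-zero coefficient. No
  scalars have to be tracked along a cyclic sequence. Information runs backwards: it enters at the
  final triple, whose arrow has a single shortest path, and is handed back to the starting cycle. A
  cycle taken as a path has a base point, and rotating it is not allowed in the algebra. So the
  cycle has to be followed without rotation, and the free choice of the starting arrow is what
  reaches every base point. Exchanging one shortest path for the other inside a closed walk may
  lengthen it and may create self-intersections. Hence the induction has to admit arbitrary closed
  walks, and its measure counts visited vertices instead of arrows; a non-intersecting cycle is cut
  out first. Cyclic orientation is used in two ways: a chordless cycle found from an undirected walk
  is oriented for free, and arrows are determined by their unordered pair of ends.\<close>

lemma is_walk_append:
  assumes "is_walk Q xs as" "is_walk Q ys bs" "last xs = hd ys"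
  shows "is_walk Q (xs @ tl ys) (as @ bs)"
proof -
  have len: "length xs = Suc (length as)" "length ys = Suc (length bs)"
    using assms by (auto simp: is_walk_def)
  have "set (tl ys) \<subseteq> set ys" by (cases ys) auto
  moreover have "{tail Q ((as @ bs) ! i), head Q ((as @ bs) ! i)} =
      {(xs @ tl ys) ! Suc i, (xs @ tl ys) ! i}" if i: "i < length (as @ bs)" for i
  proof (cases "i < length as")
    case True
    then show ?thesis using assms(1) len by (auto simp: is_walk_def nth_append)
  next
    case False
    define k where "k = i - length as"
    have k: "i = length as + k" "k < length bs" using False i by (auto simp: k_def)
    have nth: "(xs @ tl ys) ! (length as + m) = ys ! m" if "m \<le> length bs" for m
    proof (cases m)
      case 0
      have "xs \<noteq> []" "ys \<noteq> []" using len by auto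
      then show ?thesis using 0 assms(3) len
        by (simp add: nth_append last_conv_nth hd_conv_nth)
    next
      case (Suc n)
      then show ?thesis using that len by (auto simp: nth_append nth_tl)
    qed
    show ?thesis
      using assms(2) k nth[of k] nth[of "Suc k"] by (simp add: is_walk_def)
  qed
  ultimately show ?thesis
    using assms len by (auto simp: is_walk_def)
qed

lemma is_walk_take:
  "is_walk Q xs as \<Longrightarrow> is_walk Q (take (Suc n) xs) (take n as)"
  unfolding is_walk_def using set_take_subset[of "Suc n" xs] set_take_subset[of n as] by auto

lemma is_walk_drop:
  assumes "is_walk Q xs as" "n \<le> length as"
  shows "is_walk Q (drop n xs) (drop n as)"
  using assms set_drop_subset[of n xs] set_drop_subset[of n as]
  unfolding is_walk_def by (auto simp: add.commute)

lemma set_take_drop_nth: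
  assumes "j \<le> i" "i \<le> n" "length xs = Suc n"
  shows "set (take (Suc (i - j)) (drop j xs)) = (!) xs ` {j..i}"
proof -
  have "take (Suc (i - j)) (drop j xs) = map ((!) xs) [j..<Suc i]"
    using assms by (intro nth_equalityI) (auto simp del: upt_Suc)
  then show ?thesis using assms(1) by (simp add: atLeastLessThanSuc_atLeastAtMost del: upt_Suc)
qed

section \<open>Directed walks: slices, uniqueness and a test for chordless cycles\<close>

context wf_digraph
begin

lemma cas_tl_awalk_verts: "cas u p v \<Longrightarrow> tl (awalk_verts u p) = map (head G) p"
  by (cases "p = []") (simp_all add: awalk_verts_conv')

lemma awalk_nth:
  assumes "awalk u p v" "i < length p"
  shows "tail G (p ! i) = awalk_verts u p ! i" "head G (p ! i) = awalk_verts u p ! Suc i"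
proof -
  have "p \<noteq> []" using assms(2) by auto
  then show "tail G (p ! i) = awalk_verts u p ! i"
    using assms by (simp add: awalk_verts_conv nth_append)
  have "awalk_verts u p = tail G (hd p) # map (head G) p"
    using \<open>p \<noteq> []\<close> assms(1) awalk_verts_conv' by (auto simp: awalk_def)
  then show "head G (p ! i) = awalk_verts u p ! Suc i" using assms by simp
qed

lemma is_walk_awalk: "awalk u p v \<Longrightarrow> is_walk G (awalk_verts u p) p"
  unfolding is_walk_def using awalk_nth[of u p v] by (auto simp: length_awalk_verts)

lemma awalk_slice:
  assumes "awalk u p v" "j \<le> i" "i \<le> length p"
  defines "X \<equiv> (!) (awalk_verts u p)"
  shows "awalk (X j) (take (i - j) (drop j p)) (X i)"
    and "awalk_verts (X j) (take (i - j) (drop j p)) = take (Suc (i - j)) (drop j (awalk_verts u p))"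
proof -
  have cas: "cas u p v" using assms(1) by auto
  let ?V = "awalk_verts u p"
  have len: "length ?V = Suc (length p)" by (rule length_awalk_verts)
  have pre: "awlast u (take n p) = ?V ! n" if "n \<le> length p" for n
    using that len by (simp add: awalk_verts_take_conv[OF cas] take_Suc_conv_app_nth last_conv_nth min_def)
  have split: "p = take j p @ (take (i - j) (drop j p) @ drop i p)"
    using assms(2) by (metis append_take_drop_id drop_drop le_add_diff_inverse2)
  then have "awalk u (take j p @ (take (i - j) (drop j p) @ drop i p)) v" using assms(1) by simp
  then have w: "awalk (?V ! j) (take (i - j) (drop j p)) (awlast (?V ! j) (take (i - j) (drop j p)))"
    using pre[of j] assms(2,3) by (simp del: append_take_drop_id)
  have cas_drop: "cas (?V ! j) (drop j p) v"
    using cas_dropI[OF cas pre[of j]] assms(2,3) by simp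
  have verts_drop: "awalk_verts (?V ! j) (drop j p) = drop j ?V"
  proof (cases "j < length p")
    case True then show ?thesis by (simp add: awalk_verts_drop_conv[OF cas])
  next
    case False
    then have "j = length p" using assms by simp
    then show ?thesis using len by (simp add: Cons_nth_drop_Suc[symmetric])
  qed
  show vs: "awalk_verts (X j) (take (i - j) (drop j p)) = take (Suc (i - j)) (drop j ?V)"
    unfolding X_def by (simp add: awalk_verts_take_conv[OF cas_drop] verts_drop)
  have "awlast (?V ! j) (take (i - j) (drop j p)) = ?V ! i"
    using vs assms(2,3) len unfolding X_def by (simp add: last_conv_nth)
  then show "awalk (X j) (take (i - j) (drop j p)) (X i)" using w by (simp add: X_def)
qed

lemma set_awalk_verts_slice:
  assumes "awalk u p v" "j \<le> i" "i \<le> length p"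
  defines "X \<equiv> (!) (awalk_verts u p)"
  shows "set (awalk_verts (X j) (take (i - j) (drop j p))) = X ` {j..i}"
  unfolding X_def awalk_slice(2)[OF assms(1-3)]
  using set_take_drop_nth[OF assms(2,3) length_awalk_verts] .

text \<open>Injectivity of \<open>tail G\<close> on \<open>A\<close> leaves one choice for each next
  arrow, and since no arrow of either walk starts at \<open>v\<close>, neither can pass through
  \<open>v\<close> before its end. It is applied to two paths inside one oriented cycle.\<close>

lemma awalk_unique:
  assumes "awalk u p v" "awalk u q v" "set p \<subseteq> A" "set q \<subseteq> A" "inj_on (tail G) A"
    and "v \<notin> tail G ` set p" "v \<notin> tail G ` set q"
  shows "p = q"
  using assms
proof (induction p arbitrary: u q)
  case Nil
  then show ?case by (cases q) (auto simp: awalk_Nil_iff awalk_Cons_iff)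
next
  case (Cons e p)
  then obtain f q' where q: "q = f # q'" by (cases q) (auto simp: awalk_Nil_iff awalk_Cons_iff)
  have "e = f" using Cons.prems q by (auto simp: awalk_Cons_iff dest: inj_onD)
  moreover have "p = q'"
    using Cons.prems q \<open>e = f\<close> by (intro Cons.IH[of "head G e"]) (auto simp: awalk_Cons_iff)
  ultimately show ?case using q by simp
qed

text \<open>The vertex list without its last entry lists the sources, without its first entry the
  targets; for a closed walk both omitted entries are \<open>u\<close>, so the multisets
  agree.\<close>

lemma closed_awalk_tail_image:
  assumes "awalk u c u"
  shows "tail G ` set c = head G ` set c"
proof (cases c)
  case (Cons e es)
  then have ne: "c \<noteq> []" by simp
  have vs: "awalk_verts u c = map (tail G) c @ [head G (last c)]"
    using ne by (simp add: awalk_verts_conv)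
  have hd: "tail G (hd c) = u" using assms Cons by (simp add: awalk_Cons_iff)
  have last: "head G (last c) = u" using vs assms by (metis awlast_of_awalk last_snoc awalkE')
  have "awalk_verts u c = u # map (head G) c"
    using awalk_verts_conv'[of u c u] ne hd assms by (auto simp: awalk_def)
  then have "map (tail G) c @ [u] = u # map (head G) c" using vs last by simp
  then have "mset (map (tail G) c @ [u]) = mset (u # map (head G) c)" by simp
  then have "mset (map (tail G) c) = mset (map (head G) c)" by simp
  then show ?thesis by (metis set_map set_mset_mset)
qed simp

end

lemma last_append_tl: "last xs = hd ys \<Longrightarrow> ys \<noteq> [] \<Longrightarrow> last (xs @ tl ys) = last ys"
  by (cases ys) auto

context wf_digraph
begin

lemma awalk_of_vertices:
  assumes "length xs = Suc (length p)" "hd xs \<in> verts G" "set p \<subseteq> arcs G"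
    and "\<And>i. i < length p \<Longrightarrow> tail G (p ! i) = xs ! i \<and> head G (p ! i) = xs ! Suc i"
  shows "awalk (hd xs) p (last xs) \<and> awalk_verts (hd xs) p = xs"
  using assms
proof (induction p arbitrary: xs)
  case Nil
  then obtain v where "xs = [v]" by (auto simp: length_Suc_conv)
  then show ?case using Nil by (simp add: awalk_Nil_iff)
next
  case (Cons e p)
  then obtain v ys where xs: "xs = v # ys" "length ys = Suc (length p)"
    by (auto simp: length_Suc_conv)
  then have "ys \<noteq> []" by auto
  have e: "e \<in> arcs G" "tail G e = v" "head G e = hd ys"
    using Cons.prems(3) Cons.prems(4)[of 0] xs \<open>ys \<noteq> []\<close> by (auto simp: hd_conv_nth)
  have "awalk (hd ys) p (last ys) \<and> awalk_verts (hd ys) p = ys"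
  proof (rule Cons.IH)
    show "hd ys \<in> verts G" using e by (metis head_in_verts)
    show "tail G (p ! i) = ys ! i \<and> head G (p ! i) = ys ! Suc i" if "i < length p" for i
      using Cons.prems(4)[of "Suc i"] that xs by simp
  qed (use xs Cons.prems in auto)
  then show ?case using xs e \<open>ys \<noteq> []\<close> by (auto simp: awalk_Cons_iff)
qed

lemma closed_w_rotate: "closed_w (p @ q) \<Longrightarrow> closed_w (q @ p)"
proof -
  assume "closed_w (p @ q)"
  then obtain u where u: "awalk u (p @ q) u" "p @ q \<noteq> []" by (auto simp: closed_w_def)
  then have "awalk u p (awlast u p)" "awalk (awlast u p) q u" by auto
  then have "awalk (awlast u p) (q @ p) (awlast u p)" using awalk_appendI by blast
  then show ?thesis using u(2) by (auto simp: closed_w_def)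
qed

text \<open>Dropping the first vertex of a closed walk leaves the heads of its arrows, so the vertex
  list can be eliminated. The resulting condition is visibly invariant under rotation, and
  distinctness of the arrows is absorbed by that of their heads.\<close>

lemma oriented_chordless_cycle_iff:
  "oriented_chordless_cycle G c \<longleftrightarrow>
     closed_w c \<and> distinct (map (head G) c) \<and>
     (\<forall>e\<in>arcs G. tail G e \<in> head G ` set c \<longrightarrow> head G e \<in> head G ` set c \<longrightarrow> e \<in> set c)"
proof -
  have "chordless_cycle G (awalk_verts u c) c \<longleftrightarrow> c \<noteq> [] \<and> distinct (map (head G) c) \<and>
     (\<forall>e\<in>arcs G. tail G e \<in> head G ` set c \<longrightarrow> head G e \<in> head G ` set c \<longrightarrow> e \<in> set c)"
    if u: "awalk u c u" for u
  proof -
    have "tl (awalk_verts u c) = map (head G) c"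
      using u by (auto intro: cas_tl_awalk_verts)
    moreover have "hd (awalk_verts u c) = last (awalk_verts u c)" using u by auto
    ultimately show ?thesis
      using is_walk_awalk[OF u]
      unfolding chordless_cycle_def nonintersecting_cycle_def is_cycle_def chord_def
      by (auto simp: distinct_map)
  qed
  then show ?thesis
    unfolding oriented_chordless_cycle_def closed_w_def by auto
qed

lemma oriented_chordless_cycle_rotate:
  "oriented_chordless_cycle G (p @ q) \<Longrightarrow> oriented_chordless_cycle G (q @ p)"
  unfolding oriented_chordless_cycle_iff using closed_w_rotate[of p q] by auto

lemma shortest_path_iff: "shortest_path G \<gamma> \<eta> \<longleftrightarrow> oriented_chordless_cycle G (\<eta> # \<gamma>)"
  unfolding shortest_path_def antiparallel_def oriented_chordless_cycle_def
  by (auto simp: awalk_Cons_iff)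

lemma shortest_pathD:
  assumes "shortest_path G \<gamma> \<eta>"
  shows "\<eta> \<in> arcs G" "awalk (head G \<eta>) \<gamma> (tail G \<eta>)" "distinct (map (head G) (\<eta> # \<gamma>))"
    "distinct (map (tail G) (\<eta> # \<gamma>))"
proof -
  show "\<eta> \<in> arcs G" "awalk (head G \<eta>) \<gamma> (tail G \<eta>)"
    using assms by (auto simp: shortest_path_def antiparallel_def)
  show d: "distinct (map (head G) (\<eta> # \<gamma>))"
    using assms unfolding shortest_path_iff oriented_chordless_cycle_iff by blast
  have "awalk (tail G \<eta>) (\<eta> # \<gamma>) (tail G \<eta>)"
    using \<open>\<eta> \<in> arcs G\<close> \<open>awalk (head G \<eta>) \<gamma> (tail G \<eta>)\<close> by (simp add: awalk_Cons_iff)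
  then have "tail G ` set (\<eta> # \<gamma>) = head G ` set (\<eta> # \<gamma>)" by (rule closed_awalk_tail_image)
  then have "card (tail G ` set (\<eta> # \<gamma>)) = length (\<eta> # \<gamma>)"
    using distinct_card[OF d] by simp
  then show "distinct (map (tail G) (\<eta> # \<gamma>))"
    by (metis card_distinct length_map set_map)
qed

end

lemma (in fin_digraph) finite_oriented_chordless_cycles: "finite {c. oriented_chordless_cycle G c}"
proof (rule finite_subset)
  show "finite {c. set c \<subseteq> arcs G \<and> distinct c}" by (rule finite_subset_distinct) simp
  show "{c. oriented_chordless_cycle G c} \<subseteq> {c. set c \<subseteq> arcs G \<and> distinct c}"
    by (auto simp: oriented_chordless_cycle_iff closed_w_def distinct_map)
qed

text \<open>Since \<open>card\<close> of an infinite set is 0, a bound on the number of shortest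
  paths limits them only together with this finiteness.\<close>

lemma (in fin_digraph) finite_shortest_paths: "finite {\<gamma>. shortest_path G \<gamma> \<eta>}"
proof -
  have "(#) \<eta> ` {\<gamma>. shortest_path G \<gamma> \<eta>} \<subseteq> {c. oriented_chordless_cycle G c}"
    by (auto simp: shortest_path_iff)
  then have "finite ((#) \<eta> ` {\<gamma>. shortest_path G \<gamma> \<eta>})"
    using finite_oriented_chordless_cycles by (rule finite_subset)
  then show ?thesis by (rule finite_imageD) simp
qed

section \<open>Consequences of cyclic orientation\<close>

locale cyclically_oriented_quiver = fin_digraph Q for Q :: "('v, 'e) pre_digraph" +
  assumes cyclically_oriented: "cyclically_oriented Q"
begin

lemma no_loop: "e \<in> arcs Q \<Longrightarrow> tail Q e \<noteq> head Q e"
proof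
  assume "e \<in> arcs Q" "tail Q e = head Q e"
  then have "is_cycle Q [tail Q e, head Q e] [e]"
    by (auto simp: is_cycle_def is_walk_def)
  then show False using cyclically_oriented unfolding cyclically_oriented_def by force
qed

text \<open>Cycles are undirected, so two arrows between the same vertices form a non-intersecting
  cycle of length 2, whether they are parallel or opposite.\<close>

lemma arc_determined_by_ends:
  assumes "e \<in> arcs Q" "f \<in> arcs Q" "{tail Q e, head Q e} = {tail Q f, head Q f}"
  shows "e = f"
proof (rule ccontr)
  assume "e \<noteq> f"
  then have "nonintersecting_cycle Q [tail Q e, head Q e, tail Q e] [e, f]"
    using assms no_loop[OF assms(1)]
    by (auto simp: nonintersecting_cycle_def is_cycle_def is_walk_def less_Suc_eq nth_Cons')
  then show False using cyclically_oriented unfolding cyclically_oriented_def by force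
qed

text \<open>
  A shortest undirected walk from the source to the target of \<open>b\<close> that avoids \<open>b\<close> closes up with \<open>b\<close>
  to a chordless cycle; this cycle has to be oriented, so the walk runs backwards along arrows.
\<close>

lemma induced_shortest_path:
  assumes b: "b \<in> arcs Q" and p: "awalk (tail Q b) p (head Q b)" "b \<notin> set p"
  obtains \<gamma> where "shortest_path Q \<gamma> b"
    "set (awalk_verts (head Q b) \<gamma>) \<subseteq> set (awalk_verts (tail Q b) p)"
proof -
  let ?x = "tail Q b" and ?y = "head Q b"
  define T where "T = set (awalk_verts ?x p)"
  \<comment> \<open>Directions are ignored in the minimisation, because a chord traversed against
    its direction must also count as a shortcut.\<close>
  define P where "P = (\<lambda>(xs, as). is_walk Q xs as \<and> hd xs = ?x \<and> last xs = ?y \<and> b \<notin> set as \<and> set xs \<subseteq> T)"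
  have "P (awalk_verts ?x p, p)"
    using p is_walk_awalk[OF p(1)] by (auto simp: P_def T_def)
  then obtain xas where "P xas" and least: "\<And>z. P z \<Longrightarrow> length (snd xas) \<le> length (snd z)"
    using ex_has_least_nat[of P _ "\<lambda>z. length (snd z)"] by blast
  obtain xs as where xas: "xas = (xs, as)" by (cases xas)
  have w: "is_walk Q xs as" "hd xs = ?x" "last xs = ?y" "b \<notin> set as" "set xs \<subseteq> T"
    using \<open>P xas\<close> by (auto simp: P_def xas)
  define n where "n = length as"
  have len: "length xs = Suc n" "length as = n" using w(1) by (auto simp: is_walk_def n_def)
  then have ends: "xs ! 0 = ?x" "xs ! n = ?y"
    using w(2,3) by (auto simp: hd_conv_nth last_conv_nth simp flip: length_0_conv)
  have verts: "xs ! i \<in> verts Q" if "i \<le> n" for i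
    using w(1) that len by (auto simp: is_walk_def)
  have arc: "as ! i \<in> arcs Q" "{tail Q (as ! i), head Q (as ! i)} = {xs ! Suc i, xs ! i}" if "i < n" for i
    using w(1) that len by (auto simp: is_walk_def)
  \<comment> \<open>Splicing a detour between positions \<open>i\<close> and \<open>j\<close> gives
    another competitor in \<open>P\<close>, so it is no shorter than the stretch it replaces. The
    empty detour will yield distinct vertices, a detour of one arrow will exclude chords.\<close>
  have shortcut: "j - i \<le> length bs"
    if ij: "i \<le> j" "j \<le> n" and q: "is_walk Q ps bs" "hd ps = xs ! i" "last ps = xs ! j" "b \<notin> set bs" "set ps \<subseteq> T"
    for i j ps bs
  proof -
    let ?ys = "take (Suc i) xs @ tl ps" and ?zs = "drop j xs"
    have ne: "ps \<noteq> []" "?zs \<noteq> []" "xs \<noteq> []" using q(1) ij len by (auto simp: is_walk_def)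
    have l1: "last (take (Suc i) xs) = hd ps"
      using ij len q(2) by (simp add: take_Suc_conv_app_nth)
    have l2: "last ?ys = hd ?zs"
      using ij len q(3) last_append_tl[OF l1 ne(1)] by (simp add: hd_drop_conv_nth)
    have "is_walk Q ?ys (take i as @ bs)"
      using is_walk_append[OF is_walk_take[OF w(1)] q(1) l1] .
    moreover have "is_walk Q ?zs (drop j as)"
      using is_walk_drop[OF w(1)] ij len by simp
    ultimately have "is_walk Q (?ys @ tl ?zs) ((take i as @ bs) @ drop j as)"
      using is_walk_append l2 by blast
    moreover have "last (?ys @ tl ?zs) = ?y"
      using last_append_tl[OF l2 ne(2)] w(3) ij len by simp
    moreover have "hd (?ys @ tl ?zs) = ?x" using w(2) ne by (simp add: hd_append)
    moreover have "b \<notin> set ((take i as @ bs) @ drop j as)"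
      using w(4) q(4) by (auto dest: in_set_takeD in_set_dropD)
    moreover have "set (?ys @ tl ?zs) \<subseteq> T"
    proof -
      have "set (tl ps) \<subseteq> set ps" "set (tl ?zs) \<subseteq> set ?zs" by (cases ps; auto) (cases ?zs; auto)
      then show ?thesis
        using w(5) q(5) set_take_subset[of "Suc i" xs] set_drop_subset[of j xs] by simp blast
    qed
    ultimately have "P (?ys @ tl ?zs, (take i as @ bs) @ drop j as)" by (simp add: P_def)
    from least[OF this] show ?thesis using ij len by (simp add: xas)
  qed
  have dist_lt: "xs ! i \<noteq> xs ! j" if "i < j" "j \<le> n" for i j
  proof
    assume eq: "xs ! i = xs ! j"
    have "xs ! j \<in> T" using w(5) len that by (auto simp: subset_iff)
    then show False
      using shortcut[of i j "[xs ! j]" "[]"] that verts[of j] eq by (auto simp: is_walk_def)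
  qed
  then have dist: "distinct xs"
    using len unfolding distinct_conv_nth by (metis less_Suc_eq_le linorder_neqE_nat)
  have chord: "e \<in> set as" if e: "e \<in> arcs Q" "e \<noteq> b" "{tail Q e, head Q e} = {xs ! i, xs ! j}" and "i < j" "j \<le> n" for e i j
  proof -
    have "is_walk Q [xs ! i, xs ! j] [e]" "set [xs ! i, xs ! j] \<subseteq> T"
      using e verts[of i] verts[of j] that w(5) len by (auto simp: is_walk_def insert_commute)
    then have "j - i \<le> 1" using shortcut[of i j "[xs ! i, xs ! j]" "[e]"] that by auto
    then have "j = Suc i" using \<open>i < j\<close> by simp
    then have "e = as ! i" using arc[of i] e that by (intro arc_determined_by_ends) auto
    then show ?thesis using that len by auto
  qed
  have set_tl: "set (tl (xs @ [?x])) = set xs"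
    using w(2) len by (cases xs) auto
  have "nonintersecting_cycle Q (xs @ [?x]) (as @ [b])"
  proof -
    have "is_walk Q [?y, ?x] [b]" using b by (auto simp: is_walk_def)
    from is_walk_append[OF w(1) this] have "is_walk Q (xs @ [?x]) (as @ [b])" using w(3) by simp
    moreover have "distinct as"
    proof -
      have "as ! i \<noteq> as ! j" if "i < j" "j < n" for i j
        using arc[of i] arc[of j] that dist_lt[of i j] dist_lt[of i "Suc j"]
        by (auto simp: doubleton_eq_iff)
      then show ?thesis using len unfolding distinct_conv_nth by (metis linorder_neqE_nat)
    qed
    ultimately show ?thesis
      using w len dist by (cases xs) (auto simp: nonintersecting_cycle_def is_cycle_def)
  qed
  moreover have "\<not> chord Q (xs @ [?x]) (as @ [b]) e" for e
  proof
    assume "chord Q (xs @ [?x]) (as @ [b]) e"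
    then have e: "e \<in> arcs Q" "e \<noteq> b" "e \<notin> set as" "tail Q e \<in> set xs" "head Q e \<in> set xs"
      unfolding chord_def set_tl by auto
    then obtain i j where ij: "i \<le> n" "tail Q e = xs ! i" "j \<le> n" "head Q e = xs ! j"
      using len by (auto simp: in_set_conv_nth less_Suc_eq_le)
    then have "i \<noteq> j" using no_loop[OF e(1)] by auto
    then consider "i < j" | "j < i" by linarith
    then show False
      using chord[of e i j] chord[of e j i] e ij by cases (auto simp: insert_commute)
  qed
  ultimately have "chordless_cycle Q (xs @ [?x]) (as @ [b])"
    unfolding chordless_cycle_def by blast
  then have or: "oriented_walk Q (xs @ [?x]) (as @ [b])"
    using cyclically_oriented unfolding cyclically_oriented_def by blast
  \<comment> \<open>The closing step of the cycle goes from \<open>?y\<close> to \<open>?x\<close>,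
    against the direction of \<open>b\<close>. This decides between the two orientations and
    reverses all of \<open>as\<close>.\<close>
  have "tail Q ((as @ [b]) ! n) \<noteq> (xs @ [?x]) ! n"
    using ends len no_loop[OF b] by (simp add: nth_append)
  then have rev: "tail Q ((as @ [b]) ! i) = (xs @ [?x]) ! Suc i \<and> head Q ((as @ [b]) ! i) = (xs @ [?x]) ! i"
    if "i < Suc n" for i
    using or that len unfolding oriented_walk_def by auto
  have rev': "tail Q (as ! i) = xs ! Suc i \<and> head Q (as ! i) = xs ! i" if "i < n" for i
    using rev[of i] that len by (auto simp: nth_append)
  have \<gamma>: "awalk ?y (rev as) ?x" "awalk_verts ?y (rev as) = rev xs"
  proof -
    have "awalk (hd (rev xs)) (rev as) (last (rev xs)) \<and> awalk_verts (hd (rev xs)) (rev as) = rev xs"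
    proof (rule awalk_of_vertices)
      show "hd (rev xs) \<in> verts Q" using w(3) b by (simp add: hd_rev)
      show "set (rev as) \<subseteq> arcs Q" using w(1) by (auto simp: is_walk_def)
      show "tail Q (rev as ! i) = rev xs ! i \<and> head Q (rev as ! i) = rev xs ! Suc i"
        if "i < length (rev as)" for i
        using rev'[of "n - Suc i"] that len by (simp add: rev_nth Suc_diff_Suc)
    qed (use len in simp)
    then show "awalk ?y (rev as) ?x" "awalk_verts ?y (rev as) = rev xs"
      using w(2,3) len by (auto simp: hd_rev last_rev)
  qed
  have cyc: "awalk ?x (b # rev as) ?x" "awalk_verts ?x (b # rev as) = ?x # rev xs"
    using \<gamma> b by (auto simp: awalk_Cons_iff)
  have heads: "map (head Q) (b # rev as) = rev xs"
    using cas_tl_awalk_verts[of ?x "b # rev as" ?x] cyc by (auto simp: awalk_def)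
  have "oriented_chordless_cycle Q (b # rev as)"
    unfolding oriented_chordless_cycle_iff
  proof (intro conjI ballI impI)
    show "closed_w (b # rev as)" using cyc by (auto simp: closed_w_def)
    show "distinct (map (head Q) (b # rev as))" using dist unfolding heads by simp
    fix e assume e: "e \<in> arcs Q" "tail Q e \<in> head Q ` set (b # rev as)" "head Q e \<in> head Q ` set (b # rev as)"
    have "head Q ` set (b # rev as) = set xs" using heads by (metis set_map set_rev)
    then have "tail Q e \<in> set xs" "head Q e \<in> set xs" using e by auto
    then show "e \<in> set (b # rev as)"
      using \<open>\<And>e. \<not> chord Q (xs @ [?x]) (as @ [b]) e\<close>[of e] e(1) set_tl unfolding chord_def by auto
  qed
  then show thesis
    using that[of "rev as"] \<gamma>(2) w(5) by (auto simp: shortest_path_iff T_def)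
qed

end

section \<open>Closed walks vanish\<close>

text \<open>
  \<open>null p\<close> stands for the path \<open>p\<close> being zero in the Jacobian algebra; \<open>null_flip\<close> is what the
  relation \<open>\<partial>\<^sub>\<eta> W = 0\<close> says if one shortest path \<open>\<rho>\<close> is expressed by the others.
\<close>

locale null_walks = cyclically_oriented_quiver Q for Q :: "('v, 'e) pre_digraph" +
  fixes null :: "'e list \<Rightarrow> bool"
  assumes null_factor: "\<And>u q p r v. awalk u (q @ p @ r) v \<Longrightarrow> p \<noteq> [] \<Longrightarrow> null p \<Longrightarrow> null (q @ p @ r)"
    and null_flip: "\<And>\<rho> \<eta> u q r v. shortest_path Q \<rho> \<eta> \<Longrightarrow> awalk u (q @ \<rho> @ r) v \<Longrightarrow>
      (\<And>\<sigma>. shortest_path Q \<sigma> \<eta> \<Longrightarrow> \<sigma> \<noteq> \<rho> \<Longrightarrow> null (q @ \<sigma> @ r)) \<Longrightarrow> null (q @ \<rho> @ r)"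
    and at_most_two: "\<And>\<eta>. \<eta> \<in> arcs Q \<Longrightarrow> card {\<gamma>. shortest_path Q \<gamma> \<eta>} \<le> 2"
    and finite_sequences: "\<And>c. oriented_chordless_cycle Q c \<Longrightarrow> finite_cyclic_sequence Q c"
begin

section \<open>Finite cyclic sequences kill the oriented chordless cycles\<close>

lemma shortest_path_nonempty: "shortest_path Q \<rho> \<eta> \<Longrightarrow> \<rho> \<noteq> []"
  using shortest_pathD(1,2)[of \<rho> \<eta>] no_loop[of \<eta>] by (auto simp: awalk_Nil_iff)

lemma other_unique:
  assumes "shortest_path Q \<rho> \<eta>" "shortest_path Q \<rho>' \<eta>" "shortest_path Q \<sigma> \<eta>" "\<rho> \<noteq> \<rho>'" "\<sigma> \<noteq> \<rho>'"
  shows "\<sigma> = \<rho>"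
proof (rule ccontr)
  assume "\<sigma> \<noteq> \<rho>"
  then have "card {\<rho>, \<rho>', \<sigma>} = 3" using assms by simp
  moreover have "card {\<rho>, \<rho>', \<sigma>} \<le> card {\<gamma>. shortest_path Q \<gamma> \<eta>}"
    using assms by (intro card_mono finite_shortest_paths) auto
  ultimately show False using at_most_two[of \<eta>] shortest_pathD(1)[OF assms(1)] by simp
qed

text \<open>The bound of two shortest paths makes the definite description in
  \<open>other_shortest_path\<close> well defined.\<close>

lemma other_shortest_path_Some:
  assumes "other_shortest_path Q \<eta> \<rho>' = Some \<rho>" "shortest_path Q \<rho>' \<eta>"
  shows "shortest_path Q \<rho> \<eta>" "\<And>\<sigma>. shortest_path Q \<sigma> \<eta> \<Longrightarrow> \<sigma> \<noteq> \<rho>' \<Longrightarrow> \<sigma> = \<rho>"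
proof -
  obtain \<sigma> where \<sigma>: "shortest_path Q \<sigma> \<eta>" "\<sigma> \<noteq> \<rho>'"
    using assms(1) unfolding other_shortest_path_def by (auto split: if_splits)
  have uniq: "\<And>\<tau>. shortest_path Q \<tau> \<eta> \<Longrightarrow> \<tau> \<noteq> \<rho>' \<Longrightarrow> \<tau> = \<sigma>"
    using other_unique[OF \<sigma>(1) assms(2)] \<sigma>(2) by blast
  have "\<rho> = (THE \<rho>. shortest_path Q \<rho> \<eta> \<and> \<rho> \<noteq> \<rho>')"
    using assms(1) unfolding other_shortest_path_def by (auto split: if_splits)
  also have "\<dots> = \<sigma>" using \<sigma> uniq by (intro the_equality) blast+
  finally have "\<rho> = \<sigma>" .
  then show "shortest_path Q \<rho> \<eta>" "\<And>\<tau>. shortest_path Q \<tau> \<eta> \<Longrightarrow> \<tau> \<noteq> \<rho>' \<Longrightarrow> \<tau> = \<rho>"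
    using \<sigma> uniq by blast+
qed

lemma other_shortest_path_None:
  "other_shortest_path Q \<eta> \<rho>' = None \<Longrightarrow> shortest_path Q \<sigma> \<eta> \<Longrightarrow> \<sigma> = \<rho>'"
  unfolding other_shortest_path_def by (auto split: if_splits)

text \<open>Sources are distinct along an oriented chordless cycle, so the first arrow of the path
  is the only candidate. At even steps distinct targets single out the last arrow in the same
  way.\<close>

lemma next_arrow_odd:
  assumes "shortest_path Q (\<beta> # \<tau>) \<alpha>" "odd i"
  shows "next_arrow Q i \<alpha> (\<beta> # \<tau>) = \<beta>"
  unfolding next_arrow_def if_P[OF assms(2)]
proof (rule the_equality)
  have \<beta>: "tail Q \<beta> = head Q \<alpha>"
    using shortest_pathD(2)[OF assms(1)] unfolding awalk_Cons_iff by (elim conjE) (rule sym)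
  then show "\<beta> \<in> set (\<beta> # \<tau>) \<and> tail Q \<beta> = head Q \<alpha>" by simp
  fix b assume "b \<in> set (\<beta> # \<tau>) \<and> tail Q b = head Q \<alpha>"
  then have "b \<in> set (\<beta> # \<tau>)" "tail Q b = tail Q \<beta>" using \<beta> by auto
  then show "b = \<beta>" using shortest_pathD(4)[OF assms(1)] by (auto simp: image_iff)
qed

lemma next_arrow_even:
  assumes "shortest_path Q (\<sigma> @ [\<beta>]) \<alpha>" "even i"
  shows "next_arrow Q i \<alpha> (\<sigma> @ [\<beta>]) = \<beta>"
proof -
  have not_odd: "\<not> odd i" using assms(2) by simp
  show ?thesis
    unfolding next_arrow_def if_not_P[OF not_odd]
  proof (rule the_equality)
    have \<beta>: "head Q \<beta> = tail Q \<alpha>"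
      using shortest_pathD(2)[OF assms(1)] by (simp add: awalk_simps)
    then show "\<beta> \<in> set (\<sigma> @ [\<beta>]) \<and> head Q \<beta> = tail Q \<alpha>" by simp
    fix b assume "b \<in> set (\<sigma> @ [\<beta>]) \<and> head Q b = tail Q \<alpha>"
    then have "b \<in> set (\<sigma> @ [\<beta>])" "head Q b = head Q \<beta>" using \<beta> by auto
    then show "b = \<beta>" using shortest_pathD(3)[OF assms(1)] by (auto simp: image_iff)
  qed
qed

lemma next_path_eq:
  assumes \<rho>: "shortest_path Q \<rho> \<alpha>" and \<gamma>: "shortest_path Q \<gamma> \<beta>" "set \<gamma> \<subseteq> insert \<alpha> (set \<rho>)"
  shows "next_path Q \<alpha> \<rho> \<beta> = \<gamma>"
  unfolding next_path_def
proof (rule the_equality)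
  show "shortest_path Q \<gamma> \<beta> \<and> set \<gamma> \<subseteq> insert \<alpha> (set \<rho>)" using \<gamma> by simp
  fix \<gamma>' assume \<gamma>': "shortest_path Q \<gamma>' \<beta> \<and> set \<gamma>' \<subseteq> insert \<alpha> (set \<rho>)"
  show "\<gamma>' = \<gamma>"
  proof (rule awalk_unique)
    show "inj_on (tail Q) (insert \<alpha> (set \<rho>))"
      using shortest_pathD(4)[OF \<rho>] by (simp only: distinct_map list.set)
    show "awalk (head Q \<beta>) \<gamma>' (tail Q \<beta>)" "awalk (head Q \<beta>) \<gamma> (tail Q \<beta>)"
      using \<gamma> \<gamma>' shortest_pathD(2) by blast+
    show "tail Q \<beta> \<notin> tail Q ` set \<gamma>'" "tail Q \<beta> \<notin> tail Q ` set \<gamma>"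
      using shortest_pathD(4)[of \<gamma>' \<beta>] shortest_pathD(4)[of \<gamma> \<beta>] \<gamma> \<gamma>' by auto
  qed (use \<gamma> \<gamma>' in auto)
qed

text \<open>
  The cycle formed by the \<open>n\<close>-th arrow and path of a cyclic sequence starts at alternating ends of the
  arrow: only then is the cycle at step \<open>n + 1\<close> obtained from the one at step \<open>n\<close> by replacing
  \<open>\<rho>'\<^sub>n\<close> by \<open>\<rho>\<^sub>n\<close>, with no rotation.
\<close>

definition presented :: "nat \<Rightarrow> 'e \<Rightarrow> 'e list \<Rightarrow> 'e list" where
  "presented n \<alpha> \<rho> = (if even n then \<rho> @ [\<alpha>] else \<alpha> # \<rho>)"

text \<open>The relation at \<open>\<alpha>\<close> is used inside a closed walk, with
  \<open>\<alpha>\<close> appended or prepended according to parity. If \<open>\<rho>'\<close> is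
  the only shortest path, the second hypothesis is vacuous: a terminated sequence yields its first
  null cycle in this way.\<close>

lemma null_presented_flip:
  assumes "shortest_path Q \<rho>' \<alpha>"
    and "\<And>\<sigma>. shortest_path Q \<sigma> \<alpha> \<Longrightarrow> \<sigma> \<noteq> \<rho>' \<Longrightarrow> null (presented n \<alpha> \<sigma>)"
  shows "null (presented n \<alpha> \<rho>')"
proof (cases "even n")
  case True
  have "awalk (head Q \<alpha>) ([] @ \<rho>' @ [\<alpha>]) (head Q \<alpha>)"
    using shortest_pathD(1,2)[OF assms(1)] by (auto simp: awalk_simps)
  from null_flip[OF assms(1) this] show ?thesis
    using assms(2) True by (simp add: presented_def)
next
  case False
  have "awalk (tail Q \<alpha>) ([\<alpha>] @ \<rho>' @ []) (tail Q \<alpha>)"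
    using shortest_pathD(1,2)[OF assms(1)] by (auto simp: awalk_simps)
  from null_flip[OF assms(1) this] show ?thesis
    using assms(2) False by (simp add: presented_def)
qed

text \<open>The implication transports nullity from step \<open>n\<close> back to step 0. The first
  disjunct is needed because a sequence that has become constant repeats its triple while the parity
  in \<open>presented\<close> goes on changing; by then the starting cycle is already known to be
  null.\<close>

lemma cyclic_sequence_null:
  assumes c: "oriented_chordless_cycle Q c"
    and "cyclic_sequence Q c n = (\<alpha>, \<omega>, \<rho>')"
  shows "null (tl c @ [hd c]) \<or>
    shortest_path Q \<rho>' \<alpha> \<and> \<omega> = other_shortest_path Q \<alpha> \<rho>' \<and>
    (null (presented n \<alpha> \<rho>') \<longrightarrow> null (tl c @ [hd c]))"
  using assms(2)
proof (induction n arbitrary: \<alpha> \<omega> \<rho>')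
  case 0
  have "c \<noteq> []" using c by (auto simp: oriented_chordless_cycle_iff closed_w_def)
  then show ?case using 0 c by (auto simp: shortest_path_iff presented_def)
next
  case (Suc n)
  obtain \<alpha>0 \<omega>0 \<rho>0 where seq: "cyclic_sequence Q c n = (\<alpha>0, \<omega>0, \<rho>0)"
    by (metis prod_cases3)
  show ?case
  proof (cases "null (tl c @ [hd c])")
    case False
    with Suc.IH[OF seq] have \<rho>0: "shortest_path Q \<rho>0 \<alpha>0"
      and \<omega>0: "\<omega>0 = other_shortest_path Q \<alpha>0 \<rho>0"
      and not_null: "\<not> null (presented n \<alpha>0 \<rho>0)" by auto
    have "\<omega>0 \<noteq> None"
    proof
      assume "\<omega>0 = None"
      then have "\<sigma> = \<rho>0" if "shortest_path Q \<sigma> \<alpha>0" for \<sigma>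
        using other_shortest_path_None[OF _ that] \<omega>0 by simp
      then show False using null_presented_flip[OF \<rho>0, of n] not_null by blast
    qed
    then obtain \<rho> where Some: "\<omega>0 = Some \<rho>" by blast
    note other = other_shortest_path_Some[OF _ \<rho>0, of \<rho>]
    have \<rho>: "shortest_path Q \<rho> \<alpha>0" using other \<omega>0 Some by simp
    have flip: "\<not> null (presented n \<alpha>0 \<rho>)"
    proof
      assume *: "null (presented n \<alpha>0 \<rho>)"
      have "null (presented n \<alpha>0 \<sigma>)" if "shortest_path Q \<sigma> \<alpha>0" "\<sigma> \<noteq> \<rho>0" for \<sigma>
        using other(2)[OF _ that] \<omega>0 Some * by simp
      then show False using null_presented_flip[OF \<rho>0, of n] not_null by blast
    qed
    have "\<rho> \<noteq> []" by (rule shortest_path_nonempty[OF \<rho>])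
    \<comment> \<open>The cycle stays the same list of arrows; only the role of distinguished arrow
      moves from one end of the list to the other.\<close>
    obtain \<beta> \<tau> where next_eq: "next_arrow Q (Suc n) \<alpha>0 \<rho> = \<beta>" "shortest_path Q \<tau> \<beta>"
      "set \<tau> \<subseteq> insert \<alpha>0 (set \<rho>)" "presented (Suc n) \<beta> \<tau> = presented n \<alpha>0 \<rho>"
    proof (cases "even n")
      case True
      obtain \<beta> \<tau> where \<beta>: "\<rho> = \<beta> # \<tau>" using \<open>\<rho> \<noteq> []\<close> by (cases \<rho>) auto
      have "oriented_chordless_cycle Q ([\<alpha>0] @ \<beta> # \<tau>)" using \<rho> \<beta> by (simp add: shortest_path_iff)
      from oriented_chordless_cycle_rotate[OF this] have "shortest_path Q (\<tau> @ [\<alpha>0]) \<beta>"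
        by (simp add: shortest_path_iff)
      then show ?thesis
        using next_arrow_odd[of \<beta> \<tau> \<alpha>0 "Suc n"] \<rho> \<beta> True
        by (intro that[of \<beta> "\<tau> @ [\<alpha>0]"]) (auto simp: presented_def)
    next
      case False
      obtain \<beta> \<tau> where \<beta>: "\<rho> = \<tau> @ [\<beta>]" using \<open>\<rho> \<noteq> []\<close> by (cases \<rho> rule: rev_cases) auto
      have "oriented_chordless_cycle Q ((\<alpha>0 # \<tau>) @ [\<beta>])" using \<rho> \<beta> by (simp add: shortest_path_iff)
      from oriented_chordless_cycle_rotate[OF this] have "shortest_path Q (\<alpha>0 # \<tau>) \<beta>"
        by (simp add: shortest_path_iff)
      then show ?thesis
        using next_arrow_even[of \<tau> \<beta> \<alpha>0 "Suc n"] \<rho> \<beta> False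
        by (intro that[of \<beta> "\<alpha>0 # \<tau>"]) (auto simp: presented_def)
    qed
    have "next_path Q \<alpha>0 \<rho> \<beta> = \<tau>" using next_path_eq[OF \<rho> next_eq(2,3)] .
    then have "\<alpha> = \<beta>" "\<rho>' = \<tau>" "\<omega> = other_shortest_path Q \<beta> \<tau>"
      using Suc.prems seq Some next_eq(1) by (auto simp: Let_def)
    then show ?thesis using next_eq(2,4) flip by simp
  qed simp
qed

lemma null_oriented_chordless_cycle:
  assumes "oriented_chordless_cycle Q c"
  shows "null c"
proof -
  have "c \<noteq> []" using assms by (auto simp: oriented_chordless_cycle_iff closed_w_def)
  then have c: "butlast c @ [last c] = c" by simp
  \<comment> \<open>At step 0 the distinguished arrow is presented last. So the sequence has to
    start with the last arrow of \<open>c\<close> for its first cycle to be \<open>c\<close> with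
    its own base point.\<close>
  let ?d = "last c # butlast c"
  have d: "oriented_chordless_cycle Q ?d"
  proof -
    have "oriented_chordless_cycle Q (butlast c @ [last c])" unfolding c by (rule assms)
    from oriented_chordless_cycle_rotate[OF this] show ?thesis by simp
  qed
  obtain m \<alpha> \<rho>' where "\<forall>n\<ge>m. cyclic_sequence Q ?d n = (\<alpha>, None, \<rho>')"
    using finite_sequences[OF d] unfolding finite_cyclic_sequence_def by (elim exE)
  then have "cyclic_sequence Q ?d m = (\<alpha>, None, \<rho>')" by simp
  note last = cyclic_sequence_null[OF d this]
  have "null (tl ?d @ [hd ?d])"
  proof (rule ccontr)
    assume "\<not> null (tl ?d @ [hd ?d])"
    with last have *: "shortest_path Q \<rho>' \<alpha>" "other_shortest_path Q \<alpha> \<rho>' = None"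
      "\<not> null (presented m \<alpha> \<rho>')" by auto
    then show False
      using null_presented_flip[OF *(1), of m] other_shortest_path_None[OF *(2)] by blast
  qed
  then have "null (butlast c @ [last c])" by simp
  then show ?thesis unfolding c .
qed

end

section \<open>From chordless cycles to arbitrary closed walks\<close>

context wf_digraph
begin

text \<open>If a vertex repeats after the first one, the walk without its first arrow still contains
  a closed walk; this one is shorter, and induction applies.\<close>

lemma closed_awalk_contains_cycle:
  assumes "awalk x p x" "p \<noteq> []"
  obtains q c r y where "p = q @ c @ r" "c \<noteq> []" "awalk x q y" "awalk y c y" "awalk y r x"
    "distinct (tl (awalk_verts y c))"
proof -
  have "\<exists>q c r y. p = q @ c @ r \<and> c \<noteq> [] \<and> awalk x q y \<and> awalk y c y \<and> awalk y r x \<and>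
    distinct (tl (awalk_verts y c))"
    using assms
  proof (induction "length p" arbitrary: p x rule: less_induct)
    case less
    show ?case
    proof (cases "distinct (tl (awalk_verts x p))")
      case True
      have "x \<in> verts G" using less.prems by auto
      then have "p = [] @ p @ []" "awalk x [] x" by (auto simp: awalk_Nil_iff)
      then show ?thesis using True less.prems by blast
    next
      case False
      obtain e es where p: "p = e # es" using less.prems by (cases p) auto
      have es: "e \<in> arcs G" "tail G e = x" "awalk (head G e) es x"
        using less.prems(1) p by (auto simp: awalk_Cons_iff)
      have "\<not> distinct (awalk_verts (head G e) es)" using False p by simp
      from awalk_not_distinct_decomp[OF es(3) this]
      obtain q r s w where qrs: "es = q @ r @ s" "0 < length r" "awalk (head G e) q w"
        "awalk w r w" "awalk w s x" by blast
      have "length r < length p" using p qrs by simp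
      from less.hyps[OF this qrs(4)] qrs(2)
      obtain q' c r' y where c: "r = q' @ c @ r'" "c \<noteq> []" "awalk w q' y" "awalk y c y"
        "awalk y r' w" "distinct (tl (awalk_verts y c))" by blast
      have "p = (e # q @ q') @ c @ (r' @ s)" using p qrs(1) c(1) by simp
      moreover have "awalk x (e # q @ q') y"
        using es(1,2) awalk_appendI[OF qrs(3) c(3)] unfolding awalk_Cons_iff by blast
      moreover have "awalk y (r' @ s) x" using awalk_appendI[OF c(5) qrs(5)] .
      ultimately show ?thesis using c(2,4,6) by blast
    qed
  qed
  then show thesis using that by blast
qed

text \<open>If \<open>\<phi>\<close> never dropped along an arrow, it could not be smaller at the
  end. With \<open>\<phi>\<close> the position on a cycle, this produces an arrow that runs
  backwards.\<close>

lemma awalk_decreasing_arc: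
  fixes \<phi> :: "'a \<Rightarrow> nat"
  assumes "awalk u p v" "\<phi> v < \<phi> u"
  shows "\<exists>f\<in>set p. \<phi> (head G f) < \<phi> (tail G f)"
  using assms
proof (induction p arbitrary: u)
  case Nil
  then show ?case by (simp add: awalk_Nil_iff)
next
  case (Cons e p)
  then have e: "u = tail G e" "awalk (head G e) p v" by (auto simp: awalk_Cons_iff)
  show ?case
  proof (cases "\<phi> (head G e) < \<phi> (tail G e)")
    case False
    then show ?thesis using Cons.IH[OF e(2)] Cons.prems(2) e(1) by auto
  qed simp
qed

end

context null_walks
begin

text \<open>
  In a non-intersecting cycle \<open>c\<close> that is not chordless, a backward arrow \<open>b\<close> spanning the shortest
  possible segment \<open>\<gamma>\<close> of \<open>c\<close> makes \<open>\<gamma>\<close> a shortest path to \<open>b\<close>. The rest of \<open>c\<close> is a walk parallel to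
  \<open>b\<close>, so the other shortest path to \<open>b\<close> lives on its vertices; replacing \<open>\<gamma>\<close> by it loses the inner
  vertices of \<open>\<gamma>\<close>.
\<close>

lemma null_closed_awalk:
  assumes "awalk x p x" "p \<noteq> []"
  shows "null p"
  using assms
proof (induction "card (set (awalk_verts x p))" arbitrary: x p rule: less_induct)
  case less
  obtain p1 c p2 y where dec: "p = p1 @ c @ p2" "c \<noteq> []" "awalk x p1 y" "awalk y c y" "awalk y p2 x"
    and dist: "distinct (tl (awalk_verts y c))"
    using closed_awalk_contains_cycle[OF less.prems] by blast
  define L where "L = length c"
  define X where "X = (!) (awalk_verts y c)"
  have len: "length (awalk_verts y c) = Suc L" by (simp add: length_awalk_verts L_def)
  have X0: "X 0 = y" and XL: "X L = y"
  proof -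
    have "hd (awalk_verts y c) = y" "last (awalk_verts y c) = y" using dec(4) by auto
    then show "X 0 = y" "X L = y"
      by (simp_all only: X_def hd_conv_nth last_conv_nth awalk_verts_non_Nil not_False_eq_True len diff_Suc_1)
  qed
  have X_eq: "s = 0 \<and> t = L" if "X s = X t" "s < t" "t \<le> L" for s t
  proof (cases "s = 0")
    case True
    have "t = L"
    proof (rule ccontr)
      assume "t \<noteq> L"
      then have "tl (awalk_verts y c) ! (t - 1) = tl (awalk_verts y c) ! (L - 1)"
        using that True XL X0 len by (simp add: nth_tl X_def)
      then show False
        using dist that \<open>t \<noteq> L\<close> len by (subst (asm) nth_eq_iff_index_eq) auto
    qed
    then show ?thesis using True by simp
  next
    case False
    then have "tl (awalk_verts y c) ! (s - 1) = tl (awalk_verts y c) ! (t - 1)"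
      using that len by (simp add: nth_tl X_def)
    then show ?thesis using dist that False len by (subst (asm) nth_eq_iff_index_eq) auto
  qed
  have arc: "c ! s \<in> arcs Q" "tail Q (c ! s) = X s" "head Q (c ! s) = X (Suc s)" if "s < L" for s
    using awalk_nth[OF dec(4), of s] that dec(4) nth_mem[of s c]
    by (auto simp: L_def X_def simp del: nth_mem)
  have "L > 0" using dec(2) by (simp add: L_def)
  have "L \<noteq> 1"
  proof
    assume "L = 1"
    then show False using arc[of 0] no_loop[of "c ! 0"] X0 XL by simp
  qed
  then have "L \<ge> 2" using \<open>L > 0\<close> by simp
  \<comment> \<open>Positions rather than vertices tell backward arrows from forward ones. The bound
    \<open>i - j < L\<close> excludes the pair of the two ends, where \<open>X i = X j\<close>; the
    arrow closing \<open>c\<close> shows that \<open>B\<close> is inhabited.\<close>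
  define B where "B = (\<lambda>(i, j). j < i \<and> i \<le> L \<and> i - j < L \<and> (\<exists>b\<in>arcs Q. tail Q b = X i \<and> head Q b = X j))"
  have "B (L - 1, 0)"
    using arc[of "L - 1"] \<open>L \<ge> 2\<close> X0 XL by (auto simp: B_def)
  then obtain ij where "B ij" and least: "\<And>z. B z \<Longrightarrow> fst ij - snd ij \<le> fst z - snd z"
    using ex_has_least_nat[of B _ "\<lambda>z. fst z - snd z"] by blast
  obtain i j where ij_eq: "ij = (i, j)" by (cases ij)
  have ij: "j < i" "i \<le> L" "i - j < L" using \<open>B ij\<close> by (auto simp: B_def ij_eq)
  obtain b where b: "b \<in> arcs Q" "tail Q b = X i" "head Q b = X j"
    using \<open>B ij\<close> by (auto simp: B_def ij_eq)
  have minimal: "i - j \<le> m - n"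
    if "n < m" "m \<le> L" "m - n < L" "f \<in> arcs Q" "tail Q f = X m" "head Q f = X n" for f m n
    using least[of "(m, n)"] that by (auto simp: B_def ij_eq)
  have inj: "inj_on X {j..i}"
  proof (rule inj_onI)
    fix s t assume "s \<in> {j..i}" "t \<in> {j..i}" "X s = X t"
    then show "s = t" using X_eq[of s t] X_eq[of t s] ij by (cases s t rule: linorder_cases) auto
  qed
  define \<gamma> where "\<gamma> = take (i - j) (drop j c)"
  have \<gamma>: "awalk (X j) \<gamma> (X i)" "awalk_verts (X j) \<gamma> = take (Suc (i - j)) (drop j (awalk_verts y c))"
    using awalk_slice[OF dec(4), of j i] ij by (auto simp: \<gamma>_def X_def L_def)
  have verts_\<gamma>: "set (awalk_verts (X j) \<gamma>) = X ` {j..i}"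
    using set_awalk_verts_slice[OF dec(4), of j i] ij by (auto simp: \<gamma>_def X_def L_def)
  have b\<gamma>: "awalk (X i) (b # \<gamma>) (X i)" using b \<gamma>(1) by (simp add: awalk_Cons_iff)
  have heads: "map (head Q) (b # \<gamma>) = awalk_verts (X j) \<gamma>"
    using cas_tl_awalk_verts[of "X i" "b # \<gamma>" "X i"] b\<gamma> b by (auto simp: awalk_def)
  have occ: "oriented_chordless_cycle Q (b # \<gamma>)"
    unfolding oriented_chordless_cycle_iff
  proof (intro conjI ballI impI)
    show "closed_w (b # \<gamma>)" using b\<gamma> by (auto simp: closed_w_def)
    have "card (set (awalk_verts (X j) \<gamma>)) = length (awalk_verts (X j) \<gamma>)"
      unfolding verts_\<gamma> using card_image[OF inj] ij \<gamma>(2) len by simp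
    then show "distinct (map (head Q) (b # \<gamma>))" unfolding heads by (rule card_distinct)
    have heads_set: "head Q ` set (b # \<gamma>) = X ` {j..i}"
      using heads verts_\<gamma> by (metis set_map)
    fix e assume e: "e \<in> arcs Q" "tail Q e \<in> head Q ` set (b # \<gamma>)" "head Q e \<in> head Q ` set (b # \<gamma>)"
    then obtain s t where st: "s \<in> {j..i}" "t \<in> {j..i}" "tail Q e = X s" "head Q e = X t"
      unfolding heads_set by auto
    have "s \<noteq> t" using no_loop[OF e(1)] st by auto
    show "e \<in> set (b # \<gamma>)"
    proof (cases "t < s")
      case True
      then have "i - j \<le> s - t" using minimal[of t s e] e(1) st ij by auto
      then have "s = i" "t = j" using st ij by auto
      then have "e = b" using arc_determined_by_ends[OF e(1) b(1)] st b by simp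
      then show ?thesis by simp
    next
      case False
      then have "s < t" using \<open>s \<noteq> t\<close> by simp
      \<comment> \<open>A forward chord \<open>e\<close> is parallel to a stretch of
        \<open>\<gamma>\<close>, hence has a shortest path on the vertices of that stretch. This
        path leads from \<open>X t\<close> back to \<open>X s\<close>, so it contains a backward
        arrow; minimality forces that arrow to span all of \<open>\<gamma>\<close>, opposite to
        \<open>e\<close>, which no quiver without 2-cycles allows.\<close>
      show ?thesis
      proof (rule ccontr)
        assume notin: "e \<notin> set (b # \<gamma>)"
        define p' where "p' = take (t - s) (drop s c)"
        have p': "awalk (tail Q e) p' (head Q e)" "set (awalk_verts (tail Q e) p') = X ` {s..t}"
          using awalk_slice(1)[OF dec(4), of s t] set_awalk_verts_slice[OF dec(4), of s t] \<open>s < t\<close> ij st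
          by (auto simp: p'_def X_def L_def)
        have "set p' \<subseteq> set \<gamma>"
        proof
          fix f assume "f \<in> set p'"
          then obtain m where m: "m < t - s" "f = c ! (s + m)"
            using st ij by (auto simp: p'_def in_set_conv_nth)
          then have "f = \<gamma> ! (s + m - j)" "s + m - j < length \<gamma>"
            using st ij by (auto simp: \<gamma>_def L_def)
          then show "f \<in> set \<gamma>" by simp
        qed
        then have "e \<notin> set p'" using notin by auto
        from induced_shortest_path[OF e(1) p'(1) this] obtain \<delta>
          where \<delta>: "shortest_path Q \<delta> e" "set (awalk_verts (head Q e) \<delta>) \<subseteq> X ` {s..t}"
          unfolding p'(2) .
        have \<delta>_walk: "awalk (X t) \<delta> (X s)" using shortest_pathD(2)[OF \<delta>(1)] st by simp
        have inj_st: "inj_on X {s..t}" using inj st by (auto elim: inj_on_subset)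
        let ?\<phi> = "inv_into {s..t} X"
        have \<phi>: "?\<phi> (X m) = m" if "m \<in> {s..t}" for m using inv_into_f_f[OF inj_st that] .
        have "?\<phi> (X s) < ?\<phi> (X t)" using \<phi>[of s] \<phi>[of t] \<open>s < t\<close> by simp
        from awalk_decreasing_arc[OF \<delta>_walk this]
        obtain f where f: "f \<in> set \<delta>" "?\<phi> (head Q f) < ?\<phi> (tail Q f)" by blast
        have "tail Q f \<in> X ` {s..t}" "head Q f \<in> X ` {s..t}"
          using \<delta>(2) awalk_verts_arc1[OF f(1), of "X t"] awalk_verts_arc2[OF \<delta>_walk f(1)] st by auto
        then obtain m n where mn: "m \<in> {s..t}" "n \<in> {s..t}" "tail Q f = X m" "head Q f = X n" by auto
        have "n < m" using f(2) \<phi>[of m] \<phi>[of n] mn by simp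
        have "f \<in> arcs Q" using f(1) \<delta>_walk by auto
        then have "i - j \<le> m - n" using minimal[of n m f] mn \<open>n < m\<close> st ij by auto
        then have eqs: "m = i" "n = j" "s = j" "t = i" using mn st ij by auto
        then have "f = e"
          using arc_determined_by_ends[OF \<open>f \<in> arcs Q\<close> e(1)] mn st by (simp add: insert_commute)
        then show False using eqs mn st no_loop[OF e(1)] by simp
      qed
    qed
  qed
  have "null c"
  proof (cases "i - j = L - 1")
    case True
    \<comment> \<open>Here \<open>b\<close> has the same ends as the single arrow of
      \<open>c\<close> outside \<open>\<gamma>\<close>, so the two coincide and \<open>c\<close> is
      \<open>b # \<gamma>\<close> up to rotation.\<close>
    then consider "j = 0" "i = L - 1" | "j = 1" "i = L" using ij by linarith
    then have "oriented_chordless_cycle Q c"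
    proof cases
      case 1
      have "b = c ! (L - 1)"
        using 1 b arc[of "L - 1"] \<open>L \<ge> 2\<close> X0 XL by (intro arc_determined_by_ends) auto
      then have "c = \<gamma> @ [b]"
        using 1 \<open>L \<ge> 2\<close> take_Suc_conv_app_nth[of "L - 1" c] by (simp add: \<gamma>_def L_def)
      then show ?thesis using oriented_chordless_cycle_rotate[of "[b]" \<gamma>] occ by simp
    next
      case 2
      have "b = c ! 0"
        using 2 b arc[of 0] \<open>L \<ge> 2\<close> X0 XL by (intro arc_determined_by_ends) auto
      then have "c = b # \<gamma>"
        using 2 \<open>L \<ge> 2\<close> dec(2) by (cases c) (auto simp: \<gamma>_def L_def)
      then show ?thesis using occ by simp
    qed
    then show ?thesis by (rule null_oriented_chordless_cycle)
  next
    case False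
    then have lt: "i - j < L - 1" using ij by simp
    define u where "u = take j c"
    define v where "v = drop i c"
    have c_eq: "c = u @ \<gamma> @ v"
      unfolding u_def v_def \<gamma>_def using ij
      by (metis append_take_drop_id drop_drop le_add_diff_inverse2 less_imp_le)
    have u: "awalk y u (X j)" "set (awalk_verts y u) = X ` {0..j}"
      using awalk_slice(1)[OF dec(4), of 0 j] set_awalk_verts_slice[OF dec(4), of 0 j] ij X0
      by (auto simp: u_def X_def L_def)
    have v: "awalk (X i) v y" "set (awalk_verts (X i) v) = X ` {i..L}"
      using awalk_slice(1)[OF dec(4), of i L] set_awalk_verts_slice[OF dec(4), of i L] ij XL
      by (auto simp: v_def X_def L_def)
    have vu: "awalk (tail Q b) (v @ u) (head Q b)"
      "set (awalk_verts (tail Q b) (v @ u)) = X ` {i..L} \<union> X ` {0..j}"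
      using awalk_appendI[OF v(1) u(1)] set_awalk_verts_append[OF v(1) u(1)] b u(2) v(2) by auto
    \<comment> \<open>If \<open>b\<close> were an arrow of \<open>c\<close>, then
      \<open>\<gamma>\<close>, leading from its target to its source, would consist of all other
      arrows of \<open>c\<close>, against \<open>lt\<close>.\<close>
    have "b \<notin> set (v @ u)"
    proof
      assume "b \<in> set (v @ u)"
      then have "b \<in> set c" using c_eq by auto
      then obtain s where s: "s < L" "b = c ! s" by (auto simp: in_set_conv_nth L_def)
      then have X: "X s = X i" "X (Suc s) = X j" using arc[of s] b by auto
      then consider "s = i" | "s = 0" "i = L"
        using X_eq[OF X(1)] X_eq[OF X(1)[symmetric]] s(1) ij by linarith
      then show False
      proof cases
        case 1
        then have "X j = X (Suc i)" using X(2) by simp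
        from X_eq[OF this] show False using 1 s(1) ij lt by linarith
      next
        case 2
        then have X1: "X 1 = X j" using X(2) by simp
        have "j \<noteq> 1" using 2 lt by simp
        then show False
          using X_eq[OF X1[symmetric]] X_eq[OF X1] \<open>L \<ge> 2\<close> ij by linarith
      qed
    qed
    from induced_shortest_path[OF b(1) vu(1) this] obtain \<delta>
      where \<delta>: "shortest_path Q \<delta> b" "set (awalk_verts (head Q b) \<delta>) \<subseteq> X ` {i..L} \<union> X ` {0..j}"
      unfolding vu(2) .
    have "Suc j < i"
    proof (rule ccontr)
      assume "\<not> Suc j < i"
      then have "i = Suc j" using ij by simp
      then have "b = c ! j"
        using arc[of j] b ij by (intro arc_determined_by_ends) (auto simp: insert_commute)
      then show False using arc[of j] b ij no_loop[OF b(1)] \<open>i = Suc j\<close> by simp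
    qed
    \<comment> \<open>This inner vertex of \<open>\<gamma>\<close> serves twice: it tells
      \<open>\<delta>\<close> from \<open>\<gamma>\<close>, and its loss makes the induction measure
      drop.\<close>
    have avoid: "X (Suc j) \<notin> X ` {i..L} \<union> X ` {0..j}"
    proof
      assume "X (Suc j) \<in> X ` {i..L} \<union> X ` {0..j}"
      then obtain s where s: "X (Suc j) = X s" "s \<le> L" "i \<le> s \<or> s \<le> j" using ij by auto
      then show False
        using X_eq[of "Suc j" s] X_eq[of s "Suc j"] \<open>Suc j < i\<close> ij by auto
    qed
    have \<gamma>_short: "shortest_path Q \<gamma> b" using occ by (simp add: shortest_path_iff)
    have "\<delta> \<noteq> \<gamma>"
    proof
      assume "\<delta> = \<gamma>"
      then have "X ` {j..i} \<subseteq> X ` {i..L} \<union> X ` {0..j}" using \<delta>(2) verts_\<gamma> b(3) by simp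
      moreover have "Suc j \<in> {j..i}" using ij by simp
      ultimately show False using avoid by blast
    qed
    have \<delta>_walk: "awalk (X j) \<delta> (X i)" using shortest_pathD(2)[OF \<delta>(1)] b by simp
    have "null (u @ \<delta> @ v)"
    proof (rule less.hyps)
      have \<delta>v: "awalk (X j) (\<delta> @ v) y" by (rule awalk_appendI[OF \<delta>_walk v(1)])
      show "awalk y (u @ \<delta> @ v) y" by (rule awalk_appendI[OF u(1) \<delta>v])
      show "u @ \<delta> @ v \<noteq> []" using shortest_path_nonempty[OF \<delta>(1)] by simp
      have "set (awalk_verts y (u @ \<delta> @ v)) \<subseteq> X ` {i..L} \<union> X ` {0..j}"
        unfolding set_awalk_verts_append[OF u(1) \<delta>v] set_awalk_verts_append[OF \<delta>_walk v(1)]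
        using \<delta>(2) u(2) v(2) b(3) by auto
      moreover have verts_c: "set (awalk_verts y c) = X ` {0..L}"
        using set_awalk_verts_slice[OF dec(4), of 0 L] X0 by (simp add: X_def L_def)
      moreover have "Suc j \<in> {0..L}" using \<open>Suc j < i\<close> ij by simp
      moreover have "X ` {i..L} \<union> X ` {0..j} \<subseteq> X ` {0..L}" using ij by auto
      ultimately have "set (awalk_verts y (u @ \<delta> @ v)) \<subset> set (awalk_verts y c)"
        using avoid by blast
      also have "set (awalk_verts y c) \<subseteq> set (awalk_verts x p)"
        using set_awalk_verts_append[OF dec(3) awalk_appendI[OF dec(4,5)]]
          set_awalk_verts_append[OF dec(4,5)] dec(1) by auto
      finally show "card (set (awalk_verts y (u @ \<delta> @ v))) < card (set (awalk_verts x p))"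
        by (intro psubset_card_mono) auto
    qed
    moreover have "\<sigma> = \<delta>" if "shortest_path Q \<sigma> b" "\<sigma> \<noteq> \<gamma>" for \<sigma>
      using other_unique[OF \<delta>(1) \<gamma>_short that(1) \<open>\<delta> \<noteq> \<gamma>\<close> that(2)] .
    ultimately have others: "null (u @ \<sigma> @ v)" if "shortest_path Q \<sigma> b" "\<sigma> \<noteq> \<gamma>" for \<sigma>
      using that by metis
    have "awalk y (u @ \<gamma> @ v) y" using dec(4) c_eq by simp
    from null_flip[OF \<gamma>_short this others] show ?thesis using c_eq by simp
  qed
  moreover have "awalk x (p1 @ c @ p2) x" using less.prems(1) dec(1) by simp
  ultimately show ?case using null_factor dec(1,2) by simp
qed

end

section \<open>Ideals of the complete path algebra\<close>

text \<open>Translates the positions counted by \<open>cyclic_occurrences\<close> into rotations, in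
  terms of which \<open>primitive_potential\<close> picks its representatives.\<close>

lemma rotate_eq_Cons_iff:
  assumes "j < length d"
  shows "rotate j d = \<eta> # \<gamma> \<longleftrightarrow> d ! j = \<eta> \<and> drop (Suc j) d @ take j d = \<gamma>"
  using assms by (simp add: rotate_drop_take Cons_nth_drop_Suc[symmetric])

lemma rotate_inverse:
  assumes "l \<noteq> []"
  obtains j where "j < length l" "rotate j (rotate n l) = l"
proof
  let ?k = "(length l - n mod length l) mod length l"
  show "?k < length l" using assms by simp
  have "(?k + n) mod length l = (length l - n mod length l + n mod length l) mod length l"
    by (simp only: mod_add_left_eq mod_add_right_eq)
  also have "length l - n mod length l + n mod length l = length l"
    using assms by (intro le_add_diff_inverse2 less_imp_le mod_less_divisor) simp
  finally have "(?k + n) mod length l = 0" by simp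
  then show "rotate ?k (rotate n l) = l" by (simp add: rotate_rotate rotate_id)
qed

text \<open>No cancellation can occur: for a shortest path there is one representative of its cycle
  in \<open>C\<close>, and the arrows of that cycle are distinct, so \<open>\<eta>\<close> sits at
  one position only. The derivative there is a single coefficient of the potential. Only its being
  non-zero is recorded, since its value does not influence which paths become null.\<close>

lemma (in wf_digraph) cyclic_derivative_primitive:
  fixes W :: "('a, 'b) qpath \<Rightarrow> 'k::field"
  assumes fin: "finite {c. oriented_chordless_cycle G c}" and W: "primitive_potential G W"
  shows "cyclic_derivative G \<eta> W y \<noteq> 0 \<longleftrightarrow> fst y = head G \<eta> \<and> shortest_path G (snd y) \<eta>"
proof -
  obtain C a where Ca: "(\<forall>c\<in>C. oriented_chordless_cycle G c) \<and>
      (\<forall>c. oriented_chordless_cycle G c \<longrightarrow> (\<exists>!d. d \<in> C \<and> (\<exists>n. d = rotate n c))) \<and>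
      (\<forall>c\<in>C. a c \<noteq> 0) \<and>
      W = (\<lambda>x. \<Sum>c\<in>C. a c * path_element (tail G (hd c), c) x)"
    using W unfolding primitive_potential_def by (elim exE)
  then have C: "\<And>c. c \<in> C \<Longrightarrow> oriented_chordless_cycle G c"
    and ex1: "\<And>c. oriented_chordless_cycle G c \<Longrightarrow> \<exists>!d. d \<in> C \<and> (\<exists>n. d = rotate n c)"
    and a: "\<And>c. c \<in> C \<Longrightarrow> a c \<noteq> 0"
    and W_eq: "W = (\<lambda>x. \<Sum>c\<in>C. a c * path_element (tail G (hd c), c) x)"
    by simp_all
  \<comment> \<open>Were \<open>C\<close> infinite, the sum defining \<open>W\<close> would take the
    default value 0.\<close>
  have "finite C" using C by (intro finite_subset[OF _ fin]) auto
  have W_val: "W (u, c) = (if c \<in> C \<and> u = tail G (hd c) then a c else 0)" for u c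
  proof -
    have "W (u, c) = (\<Sum>d\<in>C. if d = c then (if u = tail G (hd c) then a c else 0) else 0)"
      unfolding W_eq path_element_def by (intro sum.cong) auto
    then show ?thesis using \<open>finite C\<close> by simp
  qed
  have rot: "oriented_chordless_cycle G (rotate j c)" if "oriented_chordless_cycle G c" for c j
  proof -
    have "oriented_chordless_cycle G (take (j mod length c) c @ drop (j mod length c) c)"
      using that by simp
    from oriented_chordless_cycle_rotate[OF this] show ?thesis by (simp add: rotate_drop_take)
  qed
  show ?thesis
  proof
    assume "cyclic_derivative G \<eta> W y \<noteq> 0"
    then obtain u c j where cj: "((u, c), j) \<in> cyclic_occurrences G \<eta> y" "W (u, c) \<noteq> 0"
      unfolding cyclic_derivative_def by (auto elim!: sum.not_neutral_contains_not_neutral)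
    then have "c \<in> C" using W_val by (auto split: if_splits)
    have j: "j < length c" "c ! j = \<eta>" "y = (head G \<eta>, drop (Suc j) c @ take j c)"
      using cj(1) by (auto simp: cyclic_occurrences_def)
    then have "rotate j c = \<eta> # snd y" by (simp add: rotate_eq_Cons_iff)
    then show "fst y = head G \<eta> \<and> shortest_path G (snd y) \<eta>"
      using rot[OF C[OF \<open>c \<in> C\<close>], of j] j(3) by (simp add: shortest_path_iff)
  next
    assume y: "fst y = head G \<eta> \<and> shortest_path G (snd y) \<eta>"
    define l where "l = \<eta> # snd y"
    have l: "oriented_chordless_cycle G l" "l \<noteq> []" using y by (simp_all add: l_def shortest_path_iff)
    obtain d n where d: "d \<in> C" "d = rotate n l" using ex1[OF l(1)] by blast
    obtain j where j: "j < length d" "rotate j d = l"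
      using rotate_inverse[OF l(2), of n] d(2) by auto
    have dj: "d ! j = \<eta>" "drop (Suc j) d @ take j d = snd y"
      using j unfolding l_def by (simp_all add: rotate_eq_Cons_iff)
    have occ_d: "oriented_chordless_cycle G d" by (rule C[OF d(1)])
    then have "closed_w d" by (simp add: oriented_chordless_cycle_iff)
    then have cyc: "cyclic_path G (tail G (hd d), d)"
      by (cases d) (auto simp: closed_w_def cyclic_path_def awalk_Cons_iff)
    let ?z = "((tail G (hd d), d), j)"
    have z: "?z \<in> cyclic_occurrences G \<eta> y"
      using cyc j(1) dj y by (auto simp: cyclic_occurrences_def prod_eq_iff)
    have "cyclic_derivative G \<eta> W y = (\<Sum>z\<in>{?z}. W (fst z))"
      unfolding cyclic_derivative_def case_prod_beta
    proof (rule sum.mono_neutral_right)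
      show "\<forall>z\<in>cyclic_occurrences G \<eta> y - {?z}. W (fst z) = 0"
      proof (rule ballI, rule ccontr)
        fix z assume zin: "z \<in> cyclic_occurrences G \<eta> y - {?z}" and nz: "W (fst z) \<noteq> 0"
        obtain u c i where z_eq: "z = ((u, c), i)" by (metis surj_pair)
        have c: "c \<in> C" "u = tail G (hd c)" using nz W_val z_eq by (auto split: if_splits)
        have i: "i < length c" "c ! i = \<eta>" "drop (Suc i) c @ take i c = snd y"
          using zin z_eq by (auto simp: cyclic_occurrences_def)
        then have "rotate i c = l" unfolding l_def by (simp add: rotate_eq_Cons_iff)
        moreover have "rotate (length c - i) (rotate i c) = c"
          using i(1) by (simp add: rotate_rotate)
        ultimately have "\<exists>n. c = rotate n l" by metis
        then have "c = d" using ex1[OF l(1)] c(1) d by blast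
        moreover have "i = j"
        proof -
          have "distinct d" using occ_d by (auto simp: oriented_chordless_cycle_iff distinct_map)
          moreover have "d ! i = d ! j" using i(2) dj(1) \<open>c = d\<close> by simp
          ultimately show ?thesis using i(1) j(1) \<open>c = d\<close> nth_eq_iff_index_eq by blast
        qed
        ultimately show False using zin z_eq c by auto
      qed
    qed (use z in \<open>simp_all add: finite_cyclic_occurrences\<close>)
    then show "cyclic_derivative G \<eta> W y \<noteq> 0" using W_val d(1) a by simp
  qed
qed

section \<open>Multiplying path elements\<close>

lemma cpa_carrier_iff: "f \<in> carrier (complete_path_algebra Q) \<longleftrightarrow> (\<forall>x. f x \<noteq> 0 \<longrightarrow> is_path Q x)"
  by (simp add: complete_path_algebra_def)

lemma cpa_add: "f \<oplus>\<^bsub>complete_path_algebra Q\<^esub> g = (\<lambda>x. f x + g x)"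
  by (simp add: complete_path_algebra_def)

lemma cpa_zero: "\<zero>\<^bsub>complete_path_algebra Q\<^esub> = (\<lambda>x. 0)"
  by (simp add: complete_path_algebra_def)

lemma cpa_mult:
  "(f \<otimes>\<^bsub>complete_path_algebra Q\<^esub> g) (u, p) =
    (\<Sum>i\<le>length p. f (u, take i p) * g (last (pre_digraph.awalk_verts Q u (take i p)), drop i p))"
  by (simp add: complete_path_algebra_def)

lemma path_element_mult:
  fixes g :: "('v, 'e) qpath \<Rightarrow> 'k::field"
  shows "(path_element (u, q) \<otimes>\<^bsub>complete_path_algebra Q\<^esub> g) (w, p) =
    (if w = u \<and> take (length q) p = q
     then g (last (pre_digraph.awalk_verts Q u q), drop (length q) p) else 0)" (is "_ = ?r")
proof -
  have "(path_element (u, q) \<otimes>\<^bsub>complete_path_algebra Q\<^esub> g) (w, p) =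
    (\<Sum>i\<le>length p. if i = length q then ?r else 0)"
    unfolding cpa_mult by (intro sum.cong) (auto simp: path_element_def)
  also have "\<dots> = ?r" by auto
  finally show ?thesis .
qed

lemma path_element_append:
  "path_element (u, q) \<otimes>\<^bsub>complete_path_algebra Q\<^esub> path_element (last (pre_digraph.awalk_verts Q u q), r) =
    (path_element (u, q @ r) :: ('v, 'e) qpath \<Rightarrow> 'k::field)"
proof (rule ext, clarify)
  fix w p
  have "take (length q) p = q \<and> drop (length q) p = r \<longleftrightarrow> p = q @ r"
    by (metis append_eq_conv_conj)
  then show "(path_element (u, q) \<otimes>\<^bsub>complete_path_algebra Q\<^esub>
      path_element (last (pre_digraph.awalk_verts Q u q), r)) (w, p) =
    (path_element (u, q @ r) (w, p) :: 'k)"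
    unfolding path_element_mult by (auto simp: path_element_def)
qed

lemma path_element_carrier: "is_path Q x \<Longrightarrow> path_element x \<in> carrier (complete_path_algebra Q)"
  by (simp add: cpa_carrier_iff path_element_def)

lemma cpa_smult_left:
  "(\<lambda>x. k * f x) \<otimes>\<^bsub>complete_path_algebra Q\<^esub> g = (\<lambda>x. k * (f \<otimes>\<^bsub>complete_path_algebra Q\<^esub> g) x)"
  by (rule ext, clarify) (simp add: cpa_mult sum_distrib_left mult.assoc)

lemma cpa_smult_right:
  "f \<otimes>\<^bsub>complete_path_algebra Q\<^esub> (\<lambda>x. k * g x) = (\<lambda>x. k * (f \<otimes>\<^bsub>complete_path_algebra Q\<^esub> g) x)"
  by (rule ext, clarify) (simp add: cpa_mult sum_distrib_left mult.left_commute)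

lemma cpa_sum_left:
  "(\<lambda>x. \<Sum>i\<in>A. F i x) \<otimes>\<^bsub>complete_path_algebra Q\<^esub> g = (\<lambda>x. \<Sum>i\<in>A. (F i \<otimes>\<^bsub>complete_path_algebra Q\<^esub> g) x)"
  by (rule ext, clarify) (simp add: cpa_mult sum_distrib_right, rule sum.swap)

lemma cpa_sum_right:
  "f \<otimes>\<^bsub>complete_path_algebra Q\<^esub> (\<lambda>x. \<Sum>i\<in>A. G i x) = (\<lambda>x. \<Sum>i\<in>A. (f \<otimes>\<^bsub>complete_path_algebra Q\<^esub> G i) x)"
  by (rule ext, clarify) (simp add: cpa_mult sum_distrib_left, rule sum.swap)

lemma (in fin_digraph) finite_paths: "finite {x. is_path G x \<and> length (snd x) \<le> n}"
proof (rule finite_subset)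
  show "finite (verts G \<times> {p. set p \<subseteq> arcs G \<and> length p \<le> n})"
    by (intro finite_cartesian_product finite_lists_length_le) auto
  show "{x. is_path G x \<and> length (snd x) \<le> n} \<subseteq> verts G \<times> {p. set p \<subseteq> arcs G \<and> length p \<le> n}"
    by (force simp: is_path_def)
qed

section \<open>Paths inside an ideal\<close>

locale path_ideal = fin_digraph Q for Q :: "('v, 'e) pre_digraph" +
  fixes I :: "(('v, 'e) qpath \<Rightarrow> 'k::field) set"
  assumes ideal: "ideal I (complete_path_algebra Q)"
begin

abbreviation R :: "(('v, 'e) qpath \<Rightarrow> 'k) ring" where "R \<equiv> complete_path_algebra Q"

sublocale I: ideal I R by (rule ideal)

lemma smult_carrier: "f \<in> carrier R \<Longrightarrow> (\<lambda>x. k * f x) \<in> carrier R"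
  by (simp add: cpa_carrier_iff)

lemma smult_one_mult: "f \<in> carrier R \<Longrightarrow> (\<lambda>x. k * \<one>\<^bsub>R\<^esub> x) \<otimes>\<^bsub>R\<^esub> f = (\<lambda>x. k * f x)"
  by (simp add: cpa_smult_left)

text \<open>A ring ideal is closed under scaling because scaling is multiplication by a multiple of
  the unit, itself an element of the ring.\<close>

lemma smult_closed: "f \<in> I \<Longrightarrow> (\<lambda>x. k * f x) \<in> I"
  using I.I_l_closed[OF _ smult_carrier[OF I.one_closed, of k], of f] smult_one_mult[of f k] I.Icarr[of f]
  by simp

lemma add_closed: "f \<in> I \<Longrightarrow> g \<in> I \<Longrightarrow> (\<lambda>x. f x + g x) \<in> I"
  using additive_subgroup.a_closed[OF I.additive_subgroup_axioms, of f g] by (simp add: cpa_add)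

lemma sum_closed: "(\<And>i. i \<in> A \<Longrightarrow> F i \<in> I) \<Longrightarrow> (\<lambda>x. \<Sum>i\<in>A. F i x) \<in> I"
proof (induction A rule: infinite_finite_induct)
  case (insert i A)
  then show ?case using add_closed[of "F i" "\<lambda>x. \<Sum>i\<in>A. F i x"] by simp
qed (use additive_subgroup.zero_closed[OF I.additive_subgroup_axioms] in \<open>simp_all add: cpa_zero\<close>)

lemma path_element_factor:
  assumes w: "awalk u (q @ p @ r) v" and p: "path_element (last (awalk_verts u q), p) \<in> I"
  shows "path_element (u, q @ p @ r) \<in> I"
proof -
  let ?y = "awlast u q"
  let ?z = "awlast ?y p"
  have "is_path Q (u, q)" "is_path Q (?z, r)" using w by (auto simp: is_path_def)
  note carr = this[THEN path_element_carrier]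
  have "path_element (u, q) \<otimes>\<^bsub>R\<^esub> (path_element (?y, p) \<otimes>\<^bsub>R\<^esub> path_element (?z, r)) \<in> I"
    by (rule I.I_l_closed[OF I.I_r_closed[OF p carr(2)] carr(1)])
  then show ?thesis by (simp add: path_element_append)
qed

text \<open>Multiplying \<open>D\<close> by the paths \<open>q\<close> and \<open>r\<close> puts a
  combination of all the \<open>q @ \<sigma> @ r\<close> into \<open>I\<close>. The terms other than
  that of \<open>\<rho>\<close> can be subtracted, and the coefficient of \<open>\<rho>\<close> is
  invertible. \<open>D\<close> stands for the cyclic derivative at \<open>\<eta>\<close>.\<close>

lemma path_element_flip:
  assumes D: "D \<in> I" "\<And>y. D y \<noteq> 0 \<longleftrightarrow> fst y = head Q \<eta> \<and> shortest_path Q (snd y) \<eta>"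
    and \<rho>: "shortest_path Q \<rho> \<eta>" and w: "awalk u (q @ \<rho> @ r) v"
    and others: "\<And>\<sigma>. shortest_path Q \<sigma> \<eta> \<Longrightarrow> \<sigma> \<noteq> \<rho> \<Longrightarrow> path_element (u, q @ \<sigma> @ r) \<in> I"
    and ne: "\<rho> \<noteq> []"
  shows "path_element (u, q @ \<rho> @ r) \<in> I"
proof -
  define S where "S = {\<sigma>. shortest_path Q \<sigma> \<eta>}"
  have "finite S" unfolding S_def by (rule finite_shortest_paths)
  let ?h = "head Q \<eta>" and ?t = "tail Q \<eta>"
  define d where "d = (\<lambda>\<sigma>. D (?h, \<sigma>))"
  have D_sum: "D = (\<lambda>x. \<Sum>\<sigma>\<in>S. d \<sigma> * path_element (?h, \<sigma>) x)"
  proof (rule ext, clarify)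
    fix u p
    have "(\<Sum>\<sigma>\<in>S. d \<sigma> * path_element (?h, \<sigma>) (u, p)) = (\<Sum>\<sigma>\<in>S. if \<sigma> = p then (if u = ?h then d p else 0) else 0)"
      by (intro sum.cong) (auto simp: path_element_def)
    also have "\<dots> = D (u, p)"
      using \<open>finite S\<close> D(2)[of "(u, p)"] by (auto simp: S_def d_def)
    finally show "D (u, p) = (\<Sum>\<sigma>\<in>S. d \<sigma> * path_element (?h, \<sigma>) (u, p))" by simp
  qed
  \<comment> \<open>Since \<open>\<rho>\<close> is non-empty, its end points are determined, so
    \<open>q\<close> ends where every shortest path to \<open>\<eta>\<close> starts and the products
    below are compositions of paths.\<close>
  have ends: "awlast u q = ?h" "awlast ?h \<sigma> = ?t" if "\<sigma> \<in> S" for \<sigma>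
  proof -
    have "awalk (awlast u q) \<rho> (awlast (awlast u q) \<rho>)" using w by simp
    then show "awlast u q = ?h"
      using awalk_ends[OF _ shortest_pathD(2)[OF \<rho>]] ne by blast
    show "awlast ?h \<sigma> = ?t"
      using shortest_pathD(2)[of \<sigma> \<eta>] that by (auto simp: S_def)
  qed
  have prod: "path_element (u, q) \<otimes>\<^bsub>R\<^esub> (D \<otimes>\<^bsub>R\<^esub> path_element (?t, r)) =
      (\<lambda>x. \<Sum>\<sigma>\<in>S. d \<sigma> * path_element (u, q @ \<sigma> @ r) x)"
    unfolding D_sum cpa_sum_left cpa_sum_right cpa_smult_left cpa_smult_right
  proof (intro ext sum.cong refl)
    fix x \<sigma> assume "\<sigma> \<in> S"
    have "(path_element (?h, \<sigma>) \<otimes>\<^bsub>R\<^esub> path_element (?t, r) :: _ \<Rightarrow> 'k) = path_element (?h, \<sigma> @ r)"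
      using path_element_append[where u = ?h and q = \<sigma> and Q = Q and r = r] ends(2)[OF \<open>\<sigma> \<in> S\<close>] by simp
    moreover have "(path_element (u, q) \<otimes>\<^bsub>R\<^esub> path_element (?h, \<sigma> @ r) :: _ \<Rightarrow> 'k) = path_element (u, q @ \<sigma> @ r)"
      using path_element_append[where u = u and q = q and Q = Q and r = "\<sigma> @ r"] ends(1)[OF \<open>\<sigma> \<in> S\<close>] by simp
    ultimately show "d \<sigma> * (path_element (u, q) \<otimes>\<^bsub>R\<^esub> (path_element (?h, \<sigma>) \<otimes>\<^bsub>R\<^esub> path_element (?t, r))) x =
        d \<sigma> * path_element (u, q @ \<sigma> @ r) x" by simp
  qed
  have "\<rho> \<in> S" using \<rho> by (simp add: S_def)
  have "awalk u q (awlast u q)" "awalk (awlast (awlast u q) \<rho>) r v" using w by simp_all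
  then have "is_path Q (u, q)" "is_path Q (?t, r)"
    unfolding ends[OF \<open>\<rho> \<in> S\<close>] is_path_def fst_conv snd_conv by blast+
  note carr = this[THEN path_element_carrier]
  have "path_element (u, q) \<otimes>\<^bsub>R\<^esub> (D \<otimes>\<^bsub>R\<^esub> path_element (?t, r)) \<in> I"
    by (rule I.I_l_closed[OF I.I_r_closed[OF D(1) carr(2)] carr(1)])
  moreover have "(\<lambda>x. \<Sum>\<sigma>\<in>S - {\<rho>}. - d \<sigma> * path_element (u, q @ \<sigma> @ r) x) \<in> I"
    using others by (intro sum_closed smult_closed) (auto simp: S_def)
  ultimately have "(\<lambda>x. inverse (d \<rho>) * ((\<Sum>\<sigma>\<in>S. d \<sigma> * path_element (u, q @ \<sigma> @ r) x) +
      (\<Sum>\<sigma>\<in>S - {\<rho>}. - d \<sigma> * path_element (u, q @ \<sigma> @ r) x))) \<in> I"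
    unfolding prod by (intro smult_closed add_closed)
  moreover have "inverse (d \<rho>) * ((\<Sum>\<sigma>\<in>S. d \<sigma> * path_element (u, q @ \<sigma> @ r) x) +
      (\<Sum>\<sigma>\<in>S - {\<rho>}. - d \<sigma> * path_element (u, q @ \<sigma> @ r) x)) = path_element (u, q @ \<rho> @ r) x" for x
  proof -
    have "d \<rho> \<noteq> 0" using D(2)[of "(?h, \<rho>)"] \<rho> by (simp add: d_def)
    moreover have "(\<Sum>\<sigma>\<in>S. d \<sigma> * path_element (u, q @ \<sigma> @ r) x) = d \<rho> * path_element (u, q @ \<rho> @ r) x +
      (\<Sum>\<sigma>\<in>S - {\<rho>}. d \<sigma> * path_element (u, q @ \<sigma> @ r) x)"
      by (rule sum.remove[OF \<open>finite S\<close> \<open>\<rho> \<in> S\<close>])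
    ultimately show ?thesis by (simp add: sum_negf)
  qed
  ultimately show ?thesis by (simp only:)
qed

end

text \<open>Pigeonhole: the vertex list has one entry more than the walk has arrows.\<close>

lemma (in fin_digraph) long_awalk_contains_closed:
  assumes "awalk u p v" "card (verts G) \<le> length p"
  obtains q r s y where "p = q @ r @ s" "r \<noteq> []" "awalk u q y" "awalk y r y" "awalk y s v"
proof -
  have "\<not> distinct (awalk_verts u p)"
    using length_apath_less[of u p v] assms by (auto simp: apath_def)
  from awalk_not_distinct_decomp[OF assms(1) this] show thesis using that by fastforce
qed

context path_ideal
begin

text \<open>Ideals allow finite sums only, while \<open>f\<close> may have infinite support. But
  there are finitely many paths \<open>w\<close> of length \<open>n\<close>; collecting the terms of
  \<open>f\<close> by their initial piece \<open>w\<close> writes \<open>f\<close> as a finite sum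
  of products, in which the infinite series are the right factors.\<close>

lemma long_elements_closed:
  assumes long: "\<And>x. is_path Q x \<Longrightarrow> length (snd x) = n \<Longrightarrow> path_element x \<in> I"
    and f: "f \<in> carrier R" "\<And>x. f x \<noteq> 0 \<Longrightarrow> n \<le> length (snd x)"
  shows "f \<in> I"
proof -
  define P where "P = {x. is_path Q x \<and> length (snd x) = n}"
  have "finite P" by (rule finite_subset[OF _ finite_paths[of n]]) (auto simp: P_def)
  \<comment> \<open>\<open>g w\<close> is \<open>f\<close> divided on the left by the path
    \<open>w\<close>. The condition on \<open>v\<close> admits only continuations that start where
    \<open>w\<close> ends, which keeps \<open>g w\<close> in the algebra.\<close>
  define g where "g = (\<lambda>w (v, q). if v = awlast (fst w) (snd w) then f (fst w, snd w @ q) else 0)"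
  have path: "is_path Q x" if "f x \<noteq> 0" for x
    using f(1) that unfolding cpa_carrier_iff by blast
  have g: "g w \<in> carrier R" for w
    unfolding cpa_carrier_iff
  proof (intro allI impI)
    fix x :: "('v, 'e) qpath" assume "g w x \<noteq> 0"
    moreover obtain v q where x: "x = (v, q)" by (cases x)
    ultimately have v: "v = awlast (fst w) (snd w)" "f (fst w, snd w @ q) \<noteq> 0"
      by (auto simp: g_def split: if_splits)
    from path[OF v(2)] obtain z where "awalk (fst w) (snd w @ q) z" by (auto simp: is_path_def)
    then have "awalk v q z" unfolding v(1) by simp
    then show "is_path Q x" unfolding x is_path_def by auto
  qed
  have "(\<lambda>x. \<Sum>w\<in>P. (path_element w \<otimes>\<^bsub>R\<^esub> g w) x) \<in> I"
    using long g by (intro sum_closed I.I_r_closed) (auto simp: P_def)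
  moreover have "(\<Sum>w\<in>P. (path_element w \<otimes>\<^bsub>R\<^esub> g w) (u, p)) = f (u, p)" for u p
  proof -
    have val: "(path_element w \<otimes>\<^bsub>R\<^esub> g w) (u, p) = (if w = (u, take n p) then f (u, p) else 0)"
      if w: "w \<in> P" for w
    proof -
      obtain w1 w2 where w12: "w = (w1, w2)" by (cases w)
      then have n: "length w2 = n" using w by (simp add: P_def)
      show ?thesis
      proof (cases "take n p = w2")
        case True
        then have "w2 @ drop n p = p" by (metis append_take_drop_id)
        then show ?thesis unfolding w12 path_element_mult n using True by (simp add: g_def)
      next
        case False
        then show ?thesis unfolding w12 path_element_mult n by auto
      qed
    qed
    have "(\<Sum>w\<in>P. (path_element w \<otimes>\<^bsub>R\<^esub> g w) (u, p)) = (\<Sum>w\<in>P. if w = (u, take n p) then f (u, p) else 0)"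
      using val by (rule sum.cong[OF refl])
    also have "\<dots> = f (u, p)"
    proof (cases "f (u, p) = 0")
      case False
      have "n \<le> length p" using f(2)[OF False] by simp
      moreover obtain z where "awalk u (take n p @ drop n p) z"
        using path[OF False] by (auto simp: is_path_def)
      then have "awalk u (take n p) (awlast u (take n p))" unfolding awalk_append_iff by simp
      ultimately have "(u, take n p) \<in> P" by (auto simp: P_def is_path_def)
      then show ?thesis using \<open>finite P\<close> by simp
    qed (auto intro: sum.neutral)
    finally show ?thesis .
  qed
  then have "(\<Sum>w\<in>P. (path_element w \<otimes>\<^bsub>R\<^esub> g w) x) = f x" for x
    by (cases x) (simp only:)
  ultimately show ?thesis by simp
qed

text \<open>Lengths add under multiplication, so each further factor raises the least length by one,
  and sums keep the bound. This makes \<open>long_elements_closed\<close> applicable to the powers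
  that define the topology.\<close>

lemma arrow_ideal_power:
  "ideal_power R (arrow_ideal Q) n \<subseteq> {f \<in> carrier R. \<forall>x. f x \<noteq> 0 \<longrightarrow> n \<le> length (snd x)}"
proof (induction n)
  case (Suc n)
  show ?case
  proof
    fix f assume "f \<in> ideal_power R (arrow_ideal Q) (Suc n)"
    then have "f \<in> ideal_prod R (ideal_power R (arrow_ideal Q) n) (arrow_ideal Q)" by simp
    then show "f \<in> {f \<in> carrier R. \<forall>x. f x \<noteq> 0 \<longrightarrow> Suc n \<le> length (snd x)}"
    proof (induction f rule: ideal_prod.induct)
      case (prod f g)
      then have f: "f \<in> carrier R" "\<And>x. f x \<noteq> 0 \<Longrightarrow> n \<le> length (snd x)"
        and g: "g \<in> carrier R" "\<And>x. g x \<noteq> 0 \<Longrightarrow> 1 \<le> length (snd x)"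
        using Suc.IH by (auto simp: arrow_ideal_def)
      have "Suc n \<le> length p" if nz: "(f \<otimes>\<^bsub>R\<^esub> g) (u, p) \<noteq> 0" for u p
      proof -
        from nz obtain i where "i \<le> length p" "f (u, take i p) \<noteq> 0" "g (awlast u (take i p), drop i p) \<noteq> 0"
          unfolding cpa_mult by (auto elim!: sum.not_neutral_contains_not_neutral)
        then show ?thesis using f(2)[of "(u, take i p)"] g(2)[of "(awlast u (take i p), drop i p)"] by simp
      qed
      then show ?case using I.m_closed[OF f(1) g(1)] by auto
    next
      case (sum f g)
      then have fg: "f \<in> carrier R" "g \<in> carrier R"
        and supp: "\<And>x. f x \<noteq> 0 \<Longrightarrow> Suc n \<le> length (snd x)" "\<And>x. g x \<noteq> 0 \<Longrightarrow> Suc n \<le> length (snd x)"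
        by blast+
      have "Suc n \<le> length (snd x)" if "f x + g x \<noteq> 0" for x
      proof (cases "f x = 0")
        case True
        then show ?thesis using that supp(2)[of x] by simp
      next
        case False
        then show ?thesis by (rule supp(1))
      qed
      then show ?case using I.add.m_closed[OF fg] by (simp only: cpa_add mem_Collect_eq) blast
    qed
  qed
qed simp

text \<open>Ensures that a basic open coset contains its own representative.\<close>

lemma zero_in_arrow_ideal_power: "\<zero>\<^bsub>R\<^esub> \<in> ideal_power R (arrow_ideal Q) n"
proof (induction n)
  case (Suc n)
  have "\<zero>\<^bsub>R\<^esub> \<in> arrow_ideal Q" using I.zero_closed by (auto simp: arrow_ideal_def cpa_zero)
  then have "\<zero>\<^bsub>R\<^esub> \<otimes>\<^bsub>R\<^esub> \<zero>\<^bsub>R\<^esub> \<in> ideal_prod R (ideal_power R (arrow_ideal Q) n) (arrow_ideal Q)"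
    using Suc by (intro ideal_prod.prod)
  then show ?case by simp
qed simp

text \<open>The basic neighbourhood with exponent \<open>n\<close> of a point of the closure meets
  \<open>I\<close>, and the \<open>n\<close>-th power itself lies in \<open>I\<close>. So the point
  differs from an element of \<open>I\<close> by an element of \<open>I\<close>.\<close>

lemma closure_eq:
  assumes "\<And>x. is_path Q x \<Longrightarrow> length (snd x) = n \<Longrightarrow> path_element x \<in> I"
  shows "adic_topology R (arrow_ideal Q) closure_of I = I"
proof
  let ?T = "adic_topology R (arrow_ideal Q)"
  let ?M = "\<lambda>m. ideal_power R (arrow_ideal Q) m"
  have coset: "f \<in> ?M m +>\<^bsub>R\<^esub> g \<longleftrightarrow> (\<exists>h\<in>?M m. f = h \<oplus>\<^bsub>R\<^esub> g)" for f g m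
    by (auto simp: a_r_coset_def')
  have self: "f \<in> ?M m +>\<^bsub>R\<^esub> f" if "f \<in> carrier R" for f m
    unfolding coset using zero_in_arrow_ideal_power[of m] that
    by (intro bexI[of _ "\<zero>\<^bsub>R\<^esub>"]) simp_all
  have "carrier R \<subseteq> topspace ?T"
    unfolding adic_topology_def topology_generated_by_topspace using self by blast
  then show "I \<subseteq> ?T closure_of I"
    using I.a_subset by (intro closure_of_subset) blast
  have "topspace ?T \<subseteq> carrier R"
  proof
    fix f assume "f \<in> topspace ?T"
    then obtain m g where g: "g \<in> carrier R" "f \<in> ?M m +>\<^bsub>R\<^esub> g"
      unfolding adic_topology_def topology_generated_by_topspace by blast
    then show "f \<in> carrier R" using arrow_ideal_power[of m] unfolding coset by auto
  qed
  show "?T closure_of I \<subseteq> I"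
  proof
    fix f assume f: "f \<in> ?T closure_of I"
    then have "f \<in> carrier R" using \<open>topspace ?T \<subseteq> carrier R\<close> by (auto simp: in_closure_of)
    have "openin ?T (?M n +>\<^bsub>R\<^esub> f)"
      unfolding adic_topology_def using \<open>f \<in> carrier R\<close> by (intro topology_generated_by_Basis) blast
    then obtain g where "g \<in> I" "g \<in> ?M n +>\<^bsub>R\<^esub> f"
      using f self[OF \<open>f \<in> carrier R\<close>] unfolding in_closure_of by blast
    then obtain h where h: "h \<in> ?M n" "g = h \<oplus>\<^bsub>R\<^esub> f" unfolding coset by blast
    have "h \<in> I"
      using arrow_ideal_power[of n] h(1) by (intro long_elements_closed[OF assms]) auto
    have "(\<lambda>x. g x + (- 1) * h x) \<in> I"
      using \<open>g \<in> I\<close> \<open>h \<in> I\<close> by (intro add_closed smult_closed)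
    then show "f \<in> I" by (simp add: h(2) cpa_add)
  qed
qed

section \<open>The dimension of the quotient\<close>

definition cls :: "(('v, 'e) qpath \<Rightarrow> 'k) \<Rightarrow> (('v, 'e) qpath \<Rightarrow> 'k) set" where
  "cls f = I +>\<^bsub>R\<^esub> f"

lemma cls_add: "f \<in> carrier R \<Longrightarrow> g \<in> carrier R \<Longrightarrow> cls f \<oplus>\<^bsub>R Quot I\<^esub> cls g = cls (\<lambda>x. f x + g x)"
  using I.a_rcos_sum[of f g] by (simp add: cls_def FactRing_def cpa_add)

lemma cls_mult:
  "f \<in> carrier R \<Longrightarrow> g \<in> carrier R \<Longrightarrow> cls f \<otimes>\<^bsub>R Quot I\<^esub> cls g = cls (f \<otimes>\<^bsub>R\<^esub> g)"
  using I.rcoset_mult_add[of f g] by (simp add: cls_def FactRing_def)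

lemma cls_ideal: "f \<in> I \<Longrightarrow> cls f = \<zero>\<^bsub>R Quot I\<^esub>"
  using I.a_rcos_zero[OF ideal] by (simp add: cls_def FactRing_def)

lemma cls_carrier: "f \<in> carrier R \<Longrightarrow> cls f \<in> carrier (R Quot I)"
  by (simp add: cls_def FactRing_def I.a_rcosetsI I.a_subset)

lemma carrier_Quot: "carrier (R Quot I) = cls ` carrier R"
  by (auto simp: cls_def FactRing_def A_RCOSETS_def')

lemma cls_eqI:
  assumes "f \<in> carrier R" "g \<in> carrier R" "(\<lambda>x. f x - g x) \<in> I"
  shows "cls f = cls g"
proof -
  interpret Quot: ring "R Quot I" by (rule I.quotient_is_ring)
  have "cls f = cls (\<lambda>x. (f x - g x) + g x)" by simp
  also have "\<dots> = cls (\<lambda>x. f x - g x) \<oplus>\<^bsub>R Quot I\<^esub> cls g"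
    using assms I.a_subset by (intro cls_add[symmetric]) auto
  also have "\<dots> = cls g" using cls_ideal[OF assms(3)] cls_carrier[OF assms(2)] by simp
  finally show ?thesis .
qed

definition supported :: "('v, 'e) qpath set \<Rightarrow> (('v, 'e) qpath \<Rightarrow> 'k) set" where
  "supported P = {f \<in> carrier R. \<forall>x. f x \<noteq> 0 \<longrightarrow> x \<in> P}"

text \<open>For \<open>I\<close> the Jacobian ideal this is \<open>jacobian_scalars\<close>, up to
  unfolding \<open>cls\<close>.\<close>

definition scalars :: "(('v, 'e) qpath \<Rightarrow> 'k) set set" where
  "scalars = range (\<lambda>k. cls (\<lambda>x. k * \<one>\<^bsub>R\<^esub> x))"

text \<open>The rule \<open>Quot.Suc_dim\<close> accepts a new vector only outside the space built
  so far. So a further path \<open>y\<close> either has its class in that space already, and nothing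
  changes, or extends it by a line; no basis has to be known in advance.\<close>

lemma finite_dimension_supported:
  assumes "finite P"
  shows "ring.finite_dimension (R Quot I) scalars (cls ` supported P)"
  using assms
proof (induction P rule: finite_induct)
  case empty
  interpret Quot: ring "R Quot I" by (rule I.quotient_is_ring)
  have "supported {} = {\<zero>\<^bsub>R\<^esub>}"
    using I.zero_closed by (auto simp: supported_def cpa_zero)
  then have "cls ` supported {} = {\<zero>\<^bsub>R Quot I\<^esub>}"
    using cls_ideal[OF additive_subgroup.zero_closed[OF I.additive_subgroup_axioms]] by simp
  then show ?case
    using Quot.finite_dimensionI[OF Quot.zero_dim] by simp
next
  case (insert y P)
  interpret Quot: ring "R Quot I" by (rule I.quotient_is_ring)
  have split: "\<exists>g\<in>supported P. f = (\<lambda>x. k * path_element y x + g x)"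
    if "f \<in> supported (insert y P)" "k = f y" for f k
  proof (intro bexI)
    let ?g = "\<lambda>x. if x = y then 0 else f x"
    show "f = (\<lambda>x. k * path_element y x + ?g x)" using that(2) by (auto simp: path_element_def)
    show "?g \<in> supported P" using that(1) by (auto simp: supported_def cpa_carrier_iff)
  qed
  have sub: "supported P \<subseteq> supported (insert y P)" by (auto simp: supported_def)
  show ?case
  proof (cases "is_path Q y")
    case False
    then have "supported (insert y P) = supported P"
      by (auto simp: supported_def cpa_carrier_iff)
    then show ?thesis using insert.IH by simp
  next
    case True
    note y = path_element_carrier[OF True]
    have scaled: "(\<lambda>x. k * path_element y x) \<in> carrier R" for k by (rule smult_carrier[OF y])
    have scal: "cls (\<lambda>x. k * \<one>\<^bsub>R\<^esub> x) \<otimes>\<^bsub>R Quot I\<^esub> cls (path_element y) = cls (\<lambda>x. k * path_element y x)" for k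
      using cls_mult[OF smult_carrier[OF I.one_closed] y] smult_one_mult[OF y] by simp
    show ?thesis
    proof (cases "cls (path_element y) \<in> cls ` supported P")
      case True
      then obtain h where h: "h \<in> supported P" "cls (path_element y) = cls h" by auto
      have "cls f \<in> cls ` supported P" if f: "f \<in> supported (insert y P)" for f
      proof -
        obtain g where g: "g \<in> supported P" "f = (\<lambda>x. f y * path_element y x + g x)"
          using split[OF f refl] by blast
        have carr: "g \<in> carrier R" "h \<in> carrier R" using g h by (auto simp: supported_def)
        have "cls f = cls (\<lambda>x. f y * path_element y x) \<oplus>\<^bsub>R Quot I\<^esub> cls g"
          using cls_add[OF scaled[of "f y"] carr(1)] g(2) by simp
        also have "cls (\<lambda>x. f y * path_element y x) = cls (\<lambda>x. f y * h x)"
          unfolding scal[symmetric] h(2)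
          using cls_mult[OF smult_carrier[OF I.one_closed] carr(2)] smult_one_mult[OF carr(2)] by simp
        also have "\<dots> \<oplus>\<^bsub>R Quot I\<^esub> cls g = cls (\<lambda>x. f y * h x + g x)"
          by (rule cls_add[OF smult_carrier[OF carr(2)] carr(1)])
        finally have "cls f = cls (\<lambda>x. f y * h x + g x)" .
        moreover have "(\<lambda>x. f y * h x + g x) \<in> supported P"
        proof -
          have "h x \<noteq> 0 \<or> g x \<noteq> 0" if "f y * h x + g x \<noteq> 0" for x using that by auto
          then show ?thesis using h(1) g(1) by (fastforce simp: supported_def cpa_carrier_iff)
        qed
        ultimately show ?thesis by simp
      qed
      then have "cls ` supported (insert y P) = cls ` supported P" using sub by auto
      then show ?thesis using insert.IH by simp
    next
      case False
      obtain n where n: "Quot.dimension n scalars (cls ` supported P)"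
        using insert.IH by (auto simp: Quot.finite_dimension_def)
      have "cls ` supported (insert y P) = Quot.line_extension scalars (cls (path_element y)) (cls ` supported P)"
      proof (intro equalityI subsetI)
        fix z assume "z \<in> cls ` supported (insert y P)"
        then obtain f where f: "f \<in> supported (insert y P)" "z = cls f" by auto
        obtain g where g: "g \<in> supported P" "f = (\<lambda>x. f y * path_element y x + g x)"
          using split[OF f(1) refl] by blast
        have "z = cls (\<lambda>x. f y * \<one>\<^bsub>R\<^esub> x) \<otimes>\<^bsub>R Quot I\<^esub> cls (path_element y) \<oplus>\<^bsub>R Quot I\<^esub> cls g"
          unfolding scal f(2) using cls_add[OF scaled[of "f y"], of g] g by (simp add: supported_def)
        then show "z \<in> Quot.line_extension scalars (cls (path_element y)) (cls ` supported P)"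
          using g(1) unfolding Quot.line_extension_def scalars_def set_add_def' r_coset_def by blast
      next
        fix z assume "z \<in> Quot.line_extension scalars (cls (path_element y)) (cls ` supported P)"
        then obtain k g where g: "g \<in> supported P"
          "z = cls (\<lambda>x. k * \<one>\<^bsub>R\<^esub> x) \<otimes>\<^bsub>R Quot I\<^esub> cls (path_element y) \<oplus>\<^bsub>R Quot I\<^esub> cls g"
          unfolding Quot.line_extension_def scalars_def set_add_def' r_coset_def by blast
        then have "z = cls (\<lambda>x. k * path_element y x + g x)"
          unfolding scal using cls_add[OF scaled[of k], of g] by (simp add: supported_def)
        moreover have "(\<lambda>x. k * path_element y x + g x) \<in> supported (insert y P)"
        proof -
          have "x = y \<or> g x \<noteq> 0" if "k * path_element y x + g x \<noteq> 0" for x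
            using that by (auto simp: path_element_def split: if_splits)
          then show ?thesis using g(1) \<open>is_path Q y\<close> by (fastforce simp: supported_def cpa_carrier_iff)
        qed
        ultimately show "z \<in> cls ` supported (insert y P)" by simp
      qed
      then show ?thesis
        using Quot.finite_dimensionI[OF Quot.Suc_dim[OF cls_carrier[OF y] False n]] by simp
    qed
  qed
qed

text \<open>Cutting \<open>f\<close> off after length \<open>n\<close> changes it by an element
  supported on longer paths, which lies in \<open>I\<close>. Hence the finitely many paths of length
  at most \<open>n\<close> represent all classes.\<close>

lemma finite_dimension_Quot:
  assumes long: "\<And>x. is_path Q x \<Longrightarrow> length (snd x) = n \<Longrightarrow> path_element x \<in> I"
  shows "ring.finite_dimension (R Quot I) scalars (carrier (R Quot I))"
proof -
  let ?P = "{x. is_path Q x \<and> length (snd x) \<le> n}"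
  have "cls f \<in> cls ` supported ?P" if f: "f \<in> carrier R" for f
  proof -
    let ?g = "\<lambda>x. if length (snd x) \<le> n then f x else 0"
    have g: "?g \<in> supported ?P" using f by (auto simp: supported_def cpa_carrier_iff)
    have "(\<lambda>x. f x - ?g x) \<in> I"
      using f by (intro long_elements_closed[OF long]) (auto simp: cpa_carrier_iff split: if_splits)
    then have "cls f = cls ?g" using f g by (intro cls_eqI) (auto simp: supported_def)
    then show ?thesis using g by blast
  qed
  then have "carrier (R Quot I) = cls ` supported ?P"
    unfolding carrier_Quot by (auto simp: supported_def)
  then show ?thesis using finite_dimension_supported[OF finite_paths[of n]] by simp
qed

end

theorem theorem2:
  fixes Q :: "('v, 'e) pre_digraph"
    and W :: "('v, 'e) qpath \<Rightarrow> 'k::alg_closed_field"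
  assumes "fin_digraph Q"
    and "cyclically_oriented Q"
    and "\<forall>\<alpha>\<in>arcs Q. card {\<gamma>. shortest_path Q \<gamma> \<alpha>} \<le> 2"
    and "\<forall>c. oriented_chordless_cycle Q c \<longrightarrow> finite_cyclic_sequence Q c"
    and "primitive_potential Q W"
  shows "ring.finite_dimension (jacobian_algebra Q W) (jacobian_scalars Q W)
           (carrier (jacobian_algebra Q W))"
proof -
  let ?R = "complete_path_algebra Q :: (('v, 'e) qpath \<Rightarrow> 'k) ring"
  define I where "I = Idl\<^bsub>?R\<^esub> ((\<lambda>a. cyclic_derivative Q a W) ` arcs Q)"
  interpret cyclically_oriented_quiver Q
    using assms(1,2) by (simp add: cyclically_oriented_quiver_def cyclically_oriented_quiver_axioms_def)
  interpret R: ring ?R by (rule complete_path_algebra_ring[OF assms(1)])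
  note deriv = cyclic_derivative_primitive[OF finite_oriented_chordless_cycles assms(5)]
  have gens: "(\<lambda>a. cyclic_derivative Q a W) ` arcs Q \<subseteq> carrier ?R"
  proof clarify
    fix a
    have "is_path Q y" if "cyclic_derivative Q a W y \<noteq> 0" for y
    proof -
      have y: "fst y = head Q a" "shortest_path Q (snd y) a" using that deriv by auto
      show ?thesis using shortest_pathD(2)[OF y(2)] unfolding is_path_def y(1) by blast
    qed
    then show "cyclic_derivative Q a W \<in> carrier ?R" by (simp add: cpa_carrier_iff)
  qed
  interpret path_ideal Q I
    unfolding path_ideal_def path_ideal_axioms_def I_def
    using assms(1) R.genideal_ideal[OF gens] by blast
  have deriv_in: "cyclic_derivative Q a W \<in> I" if "a \<in> arcs Q" for a
    unfolding I_def using R.genideal_self[OF gens] that by blast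
  \<comment> \<open>Lists of arrows carry no base vertex; the source of the first arrow supplies it.
    As \<open>hd []\<close> is unspecified, \<open>null\<close> is meaningful for non-empty lists
    only, which is why \<open>null_factor\<close> asks for one.\<close>
  define null where "null p \<longleftrightarrow> path_element (tail Q (hd p), p) \<in> I" for p
  have start: "u = tail Q (hd p)" if "awalk u p v" "p \<noteq> []" for u p v
    using that by (cases p) (auto simp: awalk_Cons_iff)
  interpret null_walks Q null
  proof
    show "null (q @ p @ r)" if w: "awalk u (q @ p @ r) v" and "p \<noteq> []" "null p" for u q p r v
    proof -
      have "awlast u q = tail Q (hd p)" using start[of "awlast u q" p] w \<open>p \<noteq> []\<close> by auto
      then have "path_element (u, q @ p @ r) \<in> I"
        using path_element_factor[OF w] \<open>null p\<close> by (simp add: null_def)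
      then show ?thesis using start[OF w] \<open>p \<noteq> []\<close> by (simp add: null_def)
    qed
    show "null (q @ \<rho> @ r)" if \<rho>: "shortest_path Q \<rho> \<eta>" and w: "awalk u (q @ \<rho> @ r) v"
      and others: "\<And>\<sigma>. shortest_path Q \<sigma> \<eta> \<Longrightarrow> \<sigma> \<noteq> \<rho> \<Longrightarrow> null (q @ \<sigma> @ r)" for \<rho> \<eta> u q r v
    proof -
      have ne: "\<sigma> \<noteq> []" if "shortest_path Q \<sigma> \<eta>" for \<sigma>
        using shortest_pathD(1,2)[OF that] no_loop[of \<eta>] by (auto simp: awalk_Nil_iff)
      \<comment> \<open>Exchanging \<open>\<rho>\<close> for \<open>\<sigma>\<close> keeps the base
        vertex even if \<open>q\<close> is empty, because both paths start at
        \<open>head Q \<eta>\<close>; so all these path elements share the vertex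
        \<open>u\<close>.\<close>
      have u: "u = tail Q (hd (q @ \<sigma> @ r))" if \<sigma>: "shortest_path Q \<sigma> \<eta>" for \<sigma>
      proof (cases q)
        case Nil
        have "u = head Q \<eta>"
          using w awalk_ends[OF _ shortest_pathD(2)[OF \<rho>]] ne[OF \<rho>] Nil by (metis awalk_append_iff append_Nil)
        then show ?thesis using start[OF shortest_pathD(2)[OF \<sigma>] ne[OF \<sigma>]] ne[OF \<sigma>] Nil by simp
      next
        case (Cons e q')
        then show ?thesis using w by (simp add: awalk_Cons_iff)
      qed
      have "path_element (u, q @ \<sigma> @ r) \<in> I" if "shortest_path Q \<sigma> \<eta>" "\<sigma> \<noteq> \<rho>" for \<sigma>
        using others[OF that] unfolding null_def u[OF that(1), symmetric] .
      from path_element_flip[OF deriv_in[OF shortest_pathD(1)[OF \<rho>]] deriv \<rho> w this ne[OF \<rho>]]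
      show ?thesis unfolding null_def u[OF \<rho>, symmetric] .
    qed
  qed (use assms(3,4) in auto)
  have long: "path_element x \<in> I" if x: "is_path Q x" "length (snd x) = card (verts Q)" for x
  proof -
    obtain u p v where p: "x = (u, p)" "awalk u p v" using x(1) by (cases x) (auto simp: is_path_def)
    then have "card (verts Q) \<le> length p" using x(2) by simp
    from long_awalk_contains_closed[OF p(2) this] obtain q r s y
      where dec: "p = q @ r @ s" "r \<noteq> []" "awalk u q y" "awalk y r y" "awalk y s v" .
    have "null (q @ r @ s)"
      using null_factor[of u q r s v] null_closed_awalk[OF dec(4,2)] dec(1,2) p(2) by simp
    then show ?thesis using start[OF p(2)] dec(1,2) p(1) by (simp add: null_def)
  qed
  have J: "jacobian_ideal Q W = I"
    unfolding jacobian_ideal_def I_def[symmetric] by (rule closure_eq[OF long])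
  show ?thesis
    using finite_dimension_Quot[OF long]
    unfolding jacobian_algebra_def jacobian_scalars_def J scalars_def cls_def .
qed

end
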